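(* Let $(M,\varphi,\xi,\eta,g)$ be a $(2n+1)$-dimensional $\mathcal{F}_4^0\oplus\mathcal{F}_5^0$-manifold, let $\lambda,\mu\in\mathbb{R}$ be arbitrary, and let $\nabla'$ be the almost $\varphi$-connection defined by $$ \begin{aligned} \nabla'_xy=\nabla_xy&+\tfrac{\theta(\xi)}{2n}\{g(x,\varphi y)\xi-\eta(y)\varphi x\}+\tfrac{\theta^*(\xi)}{2n}\{g(x,y)\xi-\eta(y)x\}\\ &+\tfrac{\lambda\theta(\xi)+\mu\theta^*(\xi)}{2n}\{\eta(x)y-\eta(x)\eta(y)\xi\}+\tfrac{\mu\theta(\xi)-\lambda\theta^*(\xi)}{2n}\,\eta(x)\varphi y, \end{aligned} $$ where $\nabla$ is the Levi-Civita connection of $g$. Let $R'(x,y,z,u)=g(R'(x,y)z,u)$ be the curvature tensor of $\nabla'$ and $R(x,y,z,u)=g(R(x,y)z,u)$ that of $\nabla$. Then $R'$ is a $\varphi$-Kähler-type tensor and $$ R'=R+\tfrac{\xi\theta(\xi)}{2n}\pi_5+\tfrac{\xi\theta^*(\xi)}{2n}\pi_4+\tfrac{\theta(\xi)^2}{4n^2}\{\pi_2-\pi_4\}+\tfrac{\theta^*(\xi)^2}{4n^2}\pi_1-\tfrac{\theta(\xi)\theta^*(\xi)}{4n^2}\{\pi_3-\pi_5\}, $$ where $\xi\theta(\xi)$ and $\xi\theta^*(\xi)$ denote the derivatives of the functions $\theta(\xi)$ and $\theta^*(\xi)$ along $\xi$.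
   Context: An almost contact manifold with Norden metric $(M,\varphi,\xi,\eta,g)$ is a smooth $(2n+1)$-dimensional manifold $M$ with an endomorphism $\varphi$ of the tangent bundle, a vector field $\xi$, a 1-form $\eta$ and a pseudo-Riemannian metric $g$ such that $\varphi^2x=-x+\eta(x)\xi$, $\eta(\xi)=1$, $g(\varphi x,\varphi y)=-g(x,y)+\eta(x)\eta(y)$ for all vector fields $x,y$. (Consequently $\varphi\xi=0$, $\eta\circ\varphi=0$, $\eta(x)=g(x,\xi)$, $g(\varphi x,y)=g(x,\varphi y)$.) The fundamental tensor is $F(x,y,z)=g((\nabla_x\varphi)y,z)$. With $\{e_1,\dots,e_{2n}\}$ a basis of $\ker\eta$ at a point and $(g^{ij})$ the inverse of the matrix $(g(e_i,e_j))$, put $\theta(x)=g^{ij}F(e_i,e_j,x)$ and $\theta^*(x)=g^{ij}F(e_i,\varphi e_j,x)$ (summation over repeated indices). The classes $\mathcal{F}_4$, $\mathcal{F}_5$ are defined by $\mathcal{F}_4: F(x,y,z)=-\frac{\theta(\xi)}{2n}\{g(\varphi x,\varphi y)\eta(z)+g(\varphi x,\varphi z)\eta(y)\}$ and $\mathcal{F}_5: F(x,y,z)=-\frac{\theta^*(\xi)}{2n}\{g(\varphi x,y)\eta(z)+g(\varphi x,z)\eta(y)\}$; the manifold is in $\mathcal{F}_4\oplus\mathcal{F}_5$ if $F$ is the sum of these two right-hand sides. It is an $\mathcal{F}_4^0\oplus\mathcal{F}_5^0$-manifold if in addition the 1-forms $\theta$ and $\theta^*$ are closed. The curvature tensor of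 a linear connection $\nabla$ is $R(x,y)z=\nabla_x\nabla_yz-\nabla_y\nabla_xz-\nabla_{[x,y]}z$. A $(0,4)$-tensor $L$ is curvature-like if $L(x,y,z,u)=-L(y,x,z,u)=-L(x,y,u,z)$ and the cyclic sum of $L(x,y,z,u)$ over $x,y,z$ vanishes; a curvature-like $L$ is a $\varphi$-Kähler-type tensor if $L(x,y,\varphi z,\varphi u)=-L(x,y,z,u)$. An almost $\varphi$-connection is a linear connection $\nabla'$ with $\nabla'\varphi=0$. The tensors $\pi_i$ are: $\pi_1(x,y,z,u)=g(y,z)g(x,u)-g(x,z)g(y,u)$; $\pi_2(x,y,z,u)=g(y,\varphi z)g(x,\varphi u)-g(x,\varphi z)g(y,\varphi u)$; $\pi_3(x,y,z,u)=-g(y,z)g(x,\varphi u)+g(x,z)g(y,\varphi u)-g(x,u)g(y,\varphi z)+g(y,u)g(x,\varphi z)$; $\pi_4(x,y,z,u)=g(y,z)\eta(x)\eta(u)-g(x,z)\eta(y)\eta(u)+g(x,u)\eta(y)\eta(z)-g(y,u)\eta(x)\eta(z)$; $\pi_5(x,y,z,u)=g(y,\varphi z)\eta(x)\eta(u)-g(x,\varphi z)\eta(y)\eta(u)+g(x,\varphi u)\eta(y)\eta(z)-g(y,\varphi u)\eta(x)\eta(z)$. *)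

theory Defs
  imports "HOL-Analysis.Analysis" "HOL-Library.Function_Algebras"
begin

section \<open>Functions as a real vector space\<close>

text \<open>
  Tangent vectors are functionals on real-valued functions and vector fields are families of
  tangent vectors, so the pointwise vector space structure makes \<open>span\<close> and \<open>independent\<close> available.
\<close>

instantiation "fun" :: (type, real_vector) real_vector
begin

definition scaleR_fun_def: "scaleR r f = (\<lambda>x. r *\<^sub>R f x)"

instance
  by standard (auto simp: scaleR_fun_def fun_eq_iff algebra_simps)

end

lemma scaleR_fun_apply [simp]: "(r *\<^sub>R f) x = r *\<^sub>R f x"
  by (simp add: scaleR_fun_def)


section \<open>Smooth manifolds\<close>

primrec Ck_on :: "nat \<Rightarrow> 'e::real_normed_vector set \<Rightarrow> ('e \<Rightarrow> 'f::real_normed_vector) \<Rightarrow> bool" where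
  "Ck_on 0 S f \<longleftrightarrow> continuous_on S f"
| "Ck_on (Suc k) S f \<longleftrightarrow>
     (\<forall>x\<in>S. f differentiable (at x)) \<and> (\<forall>v. Ck_on k S (\<lambda>x. frechet_derivative f (at x) v))"

text \<open>Intended for open \<open>S\<close> only.\<close>

definition Cinf_on :: "'e::real_normed_vector set \<Rightarrow> ('e \<Rightarrow> 'f::real_normed_vector) \<Rightarrow> bool" where
  "Cinf_on S f \<longleftrightarrow> (\<forall>k. Ck_on k S f)"

text \<open>
  The underlying set of the manifold is the whole type \<open>'a\<close>, which is Hausdorff and second
  countable by its type class; \<open>'e\<close> is the model space.  An element \<open>(U, c)\<close> of the atlas is a
  chart \<open>c\<close> with domain \<open>U\<close>; the values of \<open>c\<close> outside \<open>U\<close> are irrelevant.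
\<close>

type_synonym ('a, 'e) atlas = "('a set \<times> ('a \<Rightarrow> 'e)) set"

definition smooth_atlas ::
  "('a::{t2_space,second_countable_topology}, 'e::euclidean_space) atlas \<Rightarrow> bool" where
  "smooth_atlas A \<longleftrightarrow>
     (\<Union>(U, c)\<in>A. U) = UNIV \<and>
     (\<forall>(U, c)\<in>A. open U \<and> open (c ` U) \<and> homeomorphism U (c ` U) c (inv_into U c)) \<and>
     (\<forall>(U, c)\<in>A. \<forall>(V, d)\<in>A. Cinf_on (c ` (U \<inter> V)) (d \<circ> inv_into U c))"

definition smooth_fun :: "('a, 'e::euclidean_space) atlas \<Rightarrow> ('a \<Rightarrow> real) \<Rightarrow> bool" where
  "smooth_fun A f \<longleftrightarrow> (\<forall>(U, c)\<in>A. Cinf_on (c ` U) (f \<circ> inv_into U c))"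

type_synonym 'a tvec = "('a \<Rightarrow> real) \<Rightarrow> real"
type_synonym 'a vfield = "'a \<Rightarrow> 'a tvec"

text \<open>
  Tangent vectors at \<open>p\<close> are the derivations at \<open>p\<close> of the algebra of smooth functions.  As HOL
  functions are total, the value at non-smooth arguments is fixed to be \<open>0\<close>, so that equality of
  tangent vectors is HOL equality.
\<close>

definition tangent_space :: "('a, 'e::euclidean_space) atlas \<Rightarrow> 'a \<Rightarrow> 'a tvec set" where
  "tangent_space A p = {v.
     (\<forall>f h. smooth_fun A f \<longrightarrow> smooth_fun A h \<longrightarrow> v (\<lambda>q. f q + h q) = v f + v h) \<and>
     (\<forall>r f. smooth_fun A f \<longrightarrow> v (\<lambda>q. r * f q) = r * v f) \<and>
     (\<forall>f h. smooth_fun A f \<longrightarrow> smooth_fun A h \<longrightarrow> v (\<lambda>q. f q * h q) = v f * h p + f p * v h) \<and>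
     (\<forall>f. \<not> smooth_fun A f \<longrightarrow> v f = 0)}"

definition vector_field :: "('a, 'e::euclidean_space) atlas \<Rightarrow> 'a vfield \<Rightarrow> bool" where
  "vector_field A X \<longleftrightarrow>
     (\<forall>p. X p \<in> tangent_space A p) \<and> (\<forall>f. smooth_fun A f \<longrightarrow> smooth_fun A (\<lambda>p. X p f))"

text \<open>Product of a function and a vector field.\<close>

definition fmul :: "('a \<Rightarrow> real) \<Rightarrow> 'a vfield \<Rightarrow> 'a vfield" where
  "fmul f X = (\<lambda>p. f p *\<^sub>R X p)"

definition lie_bracket :: "'a vfield \<Rightarrow> 'a vfield \<Rightarrow> 'a vfield" where
  "lie_bracket X Y = (\<lambda>p f. X p (\<lambda>q. Y q f) - Y p (\<lambda>q. X q f))"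


section \<open>Tensor fields\<close>

definition linear_at ::
  "('a, 'e::euclidean_space) atlas \<Rightarrow> 'a \<Rightarrow> ('a tvec \<Rightarrow> 'w::real_vector) \<Rightarrow> bool" where
  "linear_at A p h \<longleftrightarrow>
     (\<forall>u\<in>tangent_space A p. \<forall>v\<in>tangent_space A p. \<forall>r s. h (r *\<^sub>R u + s *\<^sub>R v) = r *\<^sub>R h u + s *\<^sub>R h v)"

definition one_form :: "('a, 'e::euclidean_space) atlas \<Rightarrow> ('a \<Rightarrow> 'a tvec \<Rightarrow> real) \<Rightarrow> bool" where
  "one_form A \<omega> \<longleftrightarrow>
     (\<forall>p. linear_at A p (\<omega> p)) \<and>
     (\<forall>X. vector_field A X \<longrightarrow> smooth_fun A (\<lambda>p. \<omega> p (X p)))"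

definition closed_one_form :: "('a, 'e::euclidean_space) atlas \<Rightarrow> ('a \<Rightarrow> 'a tvec \<Rightarrow> real) \<Rightarrow> bool" where
  "closed_one_form A \<omega> \<longleftrightarrow> one_form A \<omega> \<and>
     (\<forall>X Y. vector_field A X \<longrightarrow> vector_field A Y \<longrightarrow>
        (\<forall>p. X p (\<lambda>q. \<omega> q (Y q)) - Y p (\<lambda>q. \<omega> q (X q)) - \<omega> p (lie_bracket X Y p) = 0))"

definition endo_apply :: "('a \<Rightarrow> 'a tvec \<Rightarrow> 'a tvec) \<Rightarrow> 'a vfield \<Rightarrow> 'a vfield" where
  "endo_apply \<phi> X = (\<lambda>p. \<phi> p (X p))"

definition endomorphism_field ::
  "('a, 'e::euclidean_space) atlas \<Rightarrow> ('a \<Rightarrow> 'a tvec \<Rightarrow> 'a tvec) \<Rightarrow> bool" where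
  "endomorphism_field A \<phi> \<longleftrightarrow>
     (\<forall>p. linear_at A p (\<phi> p) \<and> \<phi> p ` tangent_space A p \<subseteq> tangent_space A p) \<and>
     (\<forall>X. vector_field A X \<longrightarrow> vector_field A (endo_apply \<phi> X))"

definition pseudo_riemannian_metric ::
  "('a, 'e::euclidean_space) atlas \<Rightarrow> ('a \<Rightarrow> 'a tvec \<Rightarrow> 'a tvec \<Rightarrow> real) \<Rightarrow> bool" where
  "pseudo_riemannian_metric A g \<longleftrightarrow>
     (\<forall>p. \<forall>u\<in>tangent_space A p. linear_at A p (g p u)) \<and>
     (\<forall>p. \<forall>u\<in>tangent_space A p. \<forall>v\<in>tangent_space A p. g p u v = g p v u) \<and>
     (\<forall>p. \<forall>u\<in>tangent_space A p. (\<forall>v\<in>tangent_space A p. g p u v = 0) \<longrightarrow> u = 0) \<and>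
     (\<forall>X Y. vector_field A X \<longrightarrow> vector_field A Y \<longrightarrow> smooth_fun A (\<lambda>p. g p (X p) (Y p)))"


section \<open>Connections and curvature\<close>

text \<open>A linear connection maps \<open>X\<close> and \<open>Y\<close> to \<open>\<nabla>\<^sub>X Y\<close>; its values on other arguments are irrelevant.\<close>

definition linear_connection ::
  "('a, 'e::euclidean_space) atlas \<Rightarrow> ('a vfield \<Rightarrow> 'a vfield \<Rightarrow> 'a vfield) \<Rightarrow> bool" where
  "linear_connection A D \<longleftrightarrow>
     (\<forall>X Y. vector_field A X \<longrightarrow> vector_field A Y \<longrightarrow> vector_field A (D X Y)) \<and>
     (\<forall>X Y Z. vector_field A X \<longrightarrow> vector_field A Y \<longrightarrow> vector_field A Z \<longrightarrow>
        D (X + Y) Z = D X Z + D Y Z \<and> D X (Y + Z) = D X Y + D X Z) \<and>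
     (\<forall>f X Y. smooth_fun A f \<longrightarrow> vector_field A X \<longrightarrow> vector_field A Y \<longrightarrow>
        D (fmul f X) Y = fmul f (D X Y) \<and>
        D X (fmul f Y) = fmul (\<lambda>p. X p f) Y + fmul f (D X Y))"

definition levi_civita_connection ::
  "('a, 'e::euclidean_space) atlas \<Rightarrow> ('a \<Rightarrow> 'a tvec \<Rightarrow> 'a tvec \<Rightarrow> real) \<Rightarrow>
   ('a vfield \<Rightarrow> 'a vfield \<Rightarrow> 'a vfield) \<Rightarrow> bool" where
  "levi_civita_connection A g D \<longleftrightarrow> linear_connection A D \<and>
     (\<forall>X Y. vector_field A X \<longrightarrow> vector_field A Y \<longrightarrow> D X Y - D Y X = lie_bracket X Y) \<and>
     (\<forall>X Y Z. vector_field A X \<longrightarrow> vector_field A Y \<longrightarrow> vector_field A Z \<longrightarrow>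
        (\<forall>p. X p (\<lambda>q. g q (Y q) (Z q)) = g p (D X Y p) (Z p) + g p (Y p) (D X Z p)))"

definition curvature ::
  "('a vfield \<Rightarrow> 'a vfield \<Rightarrow> 'a vfield) \<Rightarrow> 'a vfield \<Rightarrow> 'a vfield \<Rightarrow> 'a vfield \<Rightarrow> 'a vfield" where
  "curvature D X Y Z = D X (D Y Z) - D Y (D X Z) - D (lie_bracket X Y) Z"

definition curvature4 ::
  "('a \<Rightarrow> 'a tvec \<Rightarrow> 'a tvec \<Rightarrow> real) \<Rightarrow> ('a vfield \<Rightarrow> 'a vfield \<Rightarrow> 'a vfield) \<Rightarrow>
   'a vfield \<Rightarrow> 'a vfield \<Rightarrow> 'a vfield \<Rightarrow> 'a vfield \<Rightarrow> 'a \<Rightarrow> real" where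
  "curvature4 g D X Y Z U = (\<lambda>p. g p (curvature D X Y Z p) (U p))"

text \<open>
  Covariant tensor fields of rank four, as function-valued maps on vector fields that are
  multilinear over the smooth functions.
\<close>

definition tensor04 ::
  "('a, 'e::euclidean_space) atlas \<Rightarrow>
   ('a vfield \<Rightarrow> 'a vfield \<Rightarrow> 'a vfield \<Rightarrow> 'a vfield \<Rightarrow> 'a \<Rightarrow> real) \<Rightarrow> bool" where
  "tensor04 A L \<longleftrightarrow>
     (\<forall>X Y Z U. vector_field A X \<longrightarrow> vector_field A Y \<longrightarrow> vector_field A Z \<longrightarrow> vector_field A U \<longrightarrow>
        smooth_fun A (L X Y Z U) \<and>
        (\<forall>V. vector_field A V \<longrightarrow>
           L (X + V) Y Z U = L X Y Z U + L V Y Z U \<and>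
           L X (Y + V) Z U = L X Y Z U + L X V Z U \<and>
           L X Y (Z + V) U = L X Y Z U + L X Y V U \<and>
           L X Y Z (U + V) = L X Y Z U + L X Y Z V) \<and>
        (\<forall>f. smooth_fun A f \<longrightarrow>
           L (fmul f X) Y Z U = f * L X Y Z U \<and>
           L X (fmul f Y) Z U = f * L X Y Z U \<and>
           L X Y (fmul f Z) U = f * L X Y Z U \<and>
           L X Y Z (fmul f U) = f * L X Y Z U))"

definition curvature_like ::
  "('a, 'e::euclidean_space) atlas \<Rightarrow>
   ('a vfield \<Rightarrow> 'a vfield \<Rightarrow> 'a vfield \<Rightarrow> 'a vfield \<Rightarrow> 'a \<Rightarrow> real) \<Rightarrow> bool" where
  "curvature_like A L \<longleftrightarrow> tensor04 A L \<and>
     (\<forall>X Y Z U. vector_field A X \<longrightarrow> vector_field A Y \<longrightarrow> vector_field A Z \<longrightarrow> vector_field A U \<longrightarrow>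
        L X Y Z U = - L Y X Z U \<and>
        L X Y Z U = - L X Y U Z \<and>
        L X Y Z U + L Y Z X U + L Z X Y U = 0)"

definition phi_kaehler_type ::
  "('a, 'e::euclidean_space) atlas \<Rightarrow> ('a \<Rightarrow> 'a tvec \<Rightarrow> 'a tvec) \<Rightarrow>
   ('a vfield \<Rightarrow> 'a vfield \<Rightarrow> 'a vfield \<Rightarrow> 'a vfield \<Rightarrow> 'a \<Rightarrow> real) \<Rightarrow> bool" where
  "phi_kaehler_type A \<phi> L \<longleftrightarrow> curvature_like A L \<and>
     (\<forall>X Y Z U. vector_field A X \<longrightarrow> vector_field A Y \<longrightarrow> vector_field A Z \<longrightarrow> vector_field A U \<longrightarrow>
        L X Y (endo_apply \<phi> Z) (endo_apply \<phi> U) = - L X Y Z U)"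

text \<open>The condition \<open>\<nabla>'\<phi> = 0\<close>, where \<open>(\<nabla>'\<^sub>X\<phi>)Y = \<nabla>'\<^sub>X(\<phi>Y) - \<phi>(\<nabla>'\<^sub>X Y)\<close>.\<close>

definition almost_phi_connection ::
  "('a, 'e::euclidean_space) atlas \<Rightarrow> ('a \<Rightarrow> 'a tvec \<Rightarrow> 'a tvec) \<Rightarrow>
   ('a vfield \<Rightarrow> 'a vfield \<Rightarrow> 'a vfield) \<Rightarrow> bool" where
  "almost_phi_connection A \<phi> D \<longleftrightarrow> linear_connection A D \<and>
     (\<forall>X Y. vector_field A X \<longrightarrow> vector_field A Y \<longrightarrow>
        D X (endo_apply \<phi> Y) - endo_apply \<phi> (D X Y) = 0)"


section \<open>Almost contact manifolds with Norden metric\<close>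

definition almost_contact_norden ::
  "('a::{t2_space,second_countable_topology}, 'e::euclidean_space) atlas \<Rightarrow> nat \<Rightarrow>
   ('a \<Rightarrow> 'a tvec \<Rightarrow> 'a tvec) \<Rightarrow> 'a vfield \<Rightarrow> ('a \<Rightarrow> 'a tvec \<Rightarrow> real) \<Rightarrow>
   ('a \<Rightarrow> 'a tvec \<Rightarrow> 'a tvec \<Rightarrow> real) \<Rightarrow> bool" where
  "almost_contact_norden A n \<phi> \<xi> \<eta> g \<longleftrightarrow>
     smooth_atlas A \<and> DIM('e) = 2 * n + 1 \<and>
     endomorphism_field A \<phi> \<and> vector_field A \<xi> \<and> one_form A \<eta> \<and> pseudo_riemannian_metric A g \<and>
     (\<forall>p. \<eta> p (\<xi> p) = 1) \<and>
     (\<forall>p. \<forall>u\<in>tangent_space A p. \<phi> p (\<phi> p u) = - u + \<eta> p u *\<^sub>R \<xi> p) \<and>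
     (\<forall>p. \<forall>u\<in>tangent_space A p. \<forall>v\<in>tangent_space A p.
        g p (\<phi> p u) (\<phi> p v) = - g p u v + \<eta> p u * \<eta> p v)"

definition fundamental_tensor ::
  "('a \<Rightarrow> 'a tvec \<Rightarrow> 'a tvec) \<Rightarrow> ('a \<Rightarrow> 'a tvec \<Rightarrow> 'a tvec \<Rightarrow> real) \<Rightarrow>
   ('a vfield \<Rightarrow> 'a vfield \<Rightarrow> 'a vfield) \<Rightarrow> 'a vfield \<Rightarrow> 'a vfield \<Rightarrow> 'a vfield \<Rightarrow> 'a \<Rightarrow> real" where
  "fundamental_tensor \<phi> g D X Y Z =
     (\<lambda>p. g p ((D X (endo_apply \<phi> Y) - endo_apply \<phi> (D X Y)) p) (Z p))"

text \<open>
  The value of \<open>F\<close> on tangent vectors at a point, obtained by extending them to vector fields.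
  As \<open>F\<close> is tensorial, the value does not depend on the extensions.
\<close>

definition extend_tvec :: "('a, 'e::euclidean_space) atlas \<Rightarrow> 'a \<Rightarrow> 'a tvec \<Rightarrow> 'a vfield" where
  "extend_tvec A p u = (SOME X. vector_field A X \<and> X p = u)"

definition fundamental_tensor_at ::
  "('a, 'e::euclidean_space) atlas \<Rightarrow> ('a \<Rightarrow> 'a tvec \<Rightarrow> 'a tvec) \<Rightarrow>
   ('a \<Rightarrow> 'a tvec \<Rightarrow> 'a tvec \<Rightarrow> real) \<Rightarrow> ('a vfield \<Rightarrow> 'a vfield \<Rightarrow> 'a vfield) \<Rightarrow>
   'a \<Rightarrow> 'a tvec \<Rightarrow> 'a tvec \<Rightarrow> 'a tvec \<Rightarrow> real" where
  "fundamental_tensor_at A \<phi> g D p u v w =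
     fundamental_tensor \<phi> g D (extend_tvec A p u) (extend_tvec A p v) (extend_tvec A p w) p"

definition ker_basis ::
  "('a, 'e::euclidean_space) atlas \<Rightarrow> nat \<Rightarrow> ('a \<Rightarrow> 'a tvec \<Rightarrow> real) \<Rightarrow> 'a \<Rightarrow> (nat \<Rightarrow> 'a tvec) \<Rightarrow> bool" where
  "ker_basis A n \<eta> p e \<longleftrightarrow>
     inj_on e {..<2 * n} \<and> independent (e ` {..<2 * n}) \<and>
     span (e ` {..<2 * n}) = {u \<in> tangent_space A p. \<eta> p u = 0}"

definition gram_inverse ::
  "nat \<Rightarrow> ('v \<Rightarrow> 'v \<Rightarrow> real) \<Rightarrow> (nat \<Rightarrow> 'v) \<Rightarrow> nat \<Rightarrow> nat \<Rightarrow> real" where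
  "gram_inverse m b e =
     (SOME h. \<forall>i<m. \<forall>k<m. (\<Sum>j<m. h i j * b (e j) (e k)) = (if i = k then 1 else 0))"

text \<open>
  Both traces are independent of the basis of the kernel of \<open>\<eta>\<close>, which is therefore picked by \<open>SOME\<close>.
\<close>

definition theta ::
  "('a, 'e::euclidean_space) atlas \<Rightarrow> nat \<Rightarrow> ('a \<Rightarrow> 'a tvec \<Rightarrow> 'a tvec) \<Rightarrow> ('a \<Rightarrow> 'a tvec \<Rightarrow> real) \<Rightarrow>
   ('a \<Rightarrow> 'a tvec \<Rightarrow> 'a tvec \<Rightarrow> real) \<Rightarrow> ('a vfield \<Rightarrow> 'a vfield \<Rightarrow> 'a vfield) \<Rightarrow>
   'a \<Rightarrow> 'a tvec \<Rightarrow> real" where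
  "theta A n \<phi> \<eta> g D p x =
     (let e = (SOME e. ker_basis A n \<eta> p e)
      in \<Sum>i<2 * n. \<Sum>j<2 * n.
           gram_inverse (2 * n) (g p) e i j * fundamental_tensor_at A \<phi> g D p (e i) (e j) x)"

definition theta_star ::
  "('a, 'e::euclidean_space) atlas \<Rightarrow> nat \<Rightarrow> ('a \<Rightarrow> 'a tvec \<Rightarrow> 'a tvec) \<Rightarrow> ('a \<Rightarrow> 'a tvec \<Rightarrow> real) \<Rightarrow>
   ('a \<Rightarrow> 'a tvec \<Rightarrow> 'a tvec \<Rightarrow> real) \<Rightarrow> ('a vfield \<Rightarrow> 'a vfield \<Rightarrow> 'a vfield) \<Rightarrow>
   'a \<Rightarrow> 'a tvec \<Rightarrow> real" where
  "theta_star A n \<phi> \<eta> g D p x =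
     (let e = (SOME e. ker_basis A n \<eta> p e)
      in \<Sum>i<2 * n. \<Sum>j<2 * n.
           gram_inverse (2 * n) (g p) e i j * fundamental_tensor_at A \<phi> g D p (e i) (\<phi> p (e j)) x)"

text \<open>
  The defining right-hand sides of the classes \<open>F\<^sub>4\<close> and \<open>F\<^sub>5\<close>, for tangent vectors \<open>x\<close>, \<open>y\<close>, \<open>z\<close> at \<open>p\<close>.
\<close>

definition F4_form ::
  "('a, 'e::euclidean_space) atlas \<Rightarrow> nat \<Rightarrow> ('a \<Rightarrow> 'a tvec \<Rightarrow> 'a tvec) \<Rightarrow> 'a vfield \<Rightarrow>
   ('a \<Rightarrow> 'a tvec \<Rightarrow> real) \<Rightarrow> ('a \<Rightarrow> 'a tvec \<Rightarrow> 'a tvec \<Rightarrow> real) \<Rightarrow>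
   ('a vfield \<Rightarrow> 'a vfield \<Rightarrow> 'a vfield) \<Rightarrow> 'a \<Rightarrow> 'a tvec \<Rightarrow> 'a tvec \<Rightarrow> 'a tvec \<Rightarrow> real" where
  "F4_form A n \<phi> \<xi> \<eta> g D p x y z =
     - (theta A n \<phi> \<eta> g D p (\<xi> p) / (2 * real n)) *
       (g p (\<phi> p x) (\<phi> p y) * \<eta> p z + g p (\<phi> p x) (\<phi> p z) * \<eta> p y)"

definition F5_form ::
  "('a, 'e::euclidean_space) atlas \<Rightarrow> nat \<Rightarrow> ('a \<Rightarrow> 'a tvec \<Rightarrow> 'a tvec) \<Rightarrow> 'a vfield \<Rightarrow>
   ('a \<Rightarrow> 'a tvec \<Rightarrow> real) \<Rightarrow> ('a \<Rightarrow> 'a tvec \<Rightarrow> 'a tvec \<Rightarrow> real) \<Rightarrow>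
   ('a vfield \<Rightarrow> 'a vfield \<Rightarrow> 'a vfield) \<Rightarrow> 'a \<Rightarrow> 'a tvec \<Rightarrow> 'a tvec \<Rightarrow> 'a tvec \<Rightarrow> real" where
  "F5_form A n \<phi> \<xi> \<eta> g D p x y z =
     - (theta_star A n \<phi> \<eta> g D p (\<xi> p) / (2 * real n)) *
       (g p (\<phi> p x) y * \<eta> p z + g p (\<phi> p x) z * \<eta> p y)"

definition class_F4_F5 ::
  "('a, 'e::euclidean_space) atlas \<Rightarrow> nat \<Rightarrow> ('a \<Rightarrow> 'a tvec \<Rightarrow> 'a tvec) \<Rightarrow> 'a vfield \<Rightarrow>
   ('a \<Rightarrow> 'a tvec \<Rightarrow> real) \<Rightarrow> ('a \<Rightarrow> 'a tvec \<Rightarrow> 'a tvec \<Rightarrow> real) \<Rightarrow>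
   ('a vfield \<Rightarrow> 'a vfield \<Rightarrow> 'a vfield) \<Rightarrow> bool" where
  "class_F4_F5 A n \<phi> \<xi> \<eta> g D \<longleftrightarrow>
     (\<forall>X Y Z. vector_field A X \<longrightarrow> vector_field A Y \<longrightarrow> vector_field A Z \<longrightarrow>
        (\<forall>p. fundamental_tensor \<phi> g D X Y Z p =
             F4_form A n \<phi> \<xi> \<eta> g D p (X p) (Y p) (Z p) + F5_form A n \<phi> \<xi> \<eta> g D p (X p) (Y p) (Z p)))"

definition class_F40_F50 ::
  "('a, 'e::euclidean_space) atlas \<Rightarrow> nat \<Rightarrow> ('a \<Rightarrow> 'a tvec \<Rightarrow> 'a tvec) \<Rightarrow> 'a vfield \<Rightarrow>
   ('a \<Rightarrow> 'a tvec \<Rightarrow> real) \<Rightarrow> ('a \<Rightarrow> 'a tvec \<Rightarrow> 'a tvec \<Rightarrow> real) \<Rightarrow>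
   ('a vfield \<Rightarrow> 'a vfield \<Rightarrow> 'a vfield) \<Rightarrow> bool" where
  "class_F40_F50 A n \<phi> \<xi> \<eta> g D \<longleftrightarrow> class_F4_F5 A n \<phi> \<xi> \<eta> g D \<and>
     closed_one_form A (theta A n \<phi> \<eta> g D) \<and> closed_one_form A (theta_star A n \<phi> \<eta> g D)"


section \<open>The tensors \<open>\<pi>\<^sub>i\<close> on a single tangent space\<close>

definition pi1 :: "('v \<Rightarrow> 'v \<Rightarrow> real) \<Rightarrow> 'v \<Rightarrow> 'v \<Rightarrow> 'v \<Rightarrow> 'v \<Rightarrow> real" where
  "pi1 g x y z u = g y z * g x u - g x z * g y u"

definition pi2 :: "('v \<Rightarrow> 'v) \<Rightarrow> ('v \<Rightarrow> 'v \<Rightarrow> real) \<Rightarrow> 'v \<Rightarrow> 'v \<Rightarrow> 'v \<Rightarrow> 'v \<Rightarrow> real" where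
  "pi2 \<phi> g x y z u = g y (\<phi> z) * g x (\<phi> u) - g x (\<phi> z) * g y (\<phi> u)"

definition pi3 :: "('v \<Rightarrow> 'v) \<Rightarrow> ('v \<Rightarrow> 'v \<Rightarrow> real) \<Rightarrow> 'v \<Rightarrow> 'v \<Rightarrow> 'v \<Rightarrow> 'v \<Rightarrow> real" where
  "pi3 \<phi> g x y z u =
     - g y z * g x (\<phi> u) + g x z * g y (\<phi> u) - g x u * g y (\<phi> z) + g y u * g x (\<phi> z)"

definition pi4 :: "('v \<Rightarrow> real) \<Rightarrow> ('v \<Rightarrow> 'v \<Rightarrow> real) \<Rightarrow> 'v \<Rightarrow> 'v \<Rightarrow> 'v \<Rightarrow> 'v \<Rightarrow> real" where
  "pi4 \<eta> g x y z u =
     g y z * \<eta> x * \<eta> u - g x z * \<eta> y * \<eta> u + g x u * \<eta> y * \<eta> z - g y u * \<eta> x * \<eta> z"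

definition pi5 ::
  "('v \<Rightarrow> 'v) \<Rightarrow> ('v \<Rightarrow> real) \<Rightarrow> ('v \<Rightarrow> 'v \<Rightarrow> real) \<Rightarrow> 'v \<Rightarrow> 'v \<Rightarrow> 'v \<Rightarrow> 'v \<Rightarrow> real" where
  "pi5 \<phi> \<eta> g x y z u =
     g y (\<phi> z) * \<eta> x * \<eta> u - g x (\<phi> z) * \<eta> y * \<eta> u + g x (\<phi> u) * \<eta> y * \<eta> z - g y (\<phi> u) * \<eta> x * \<eta> z"

end

theory Submission
  imports Defs "HOL-Computational_Algebra.Polynomial"
begin

text \<open>
  Put \<open>a = \<theta>(\<xi>)/2n\<close> and \<open>b = \<theta>\<^sup>*(\<xi>)/2n\<close>.  The class condition gives
  \<open>\<nabla>\<^sub>x \<xi> = a \<phi>x + b (x - \<eta>(x) \<xi>)\<close>, which is \<open>g\<close>-symmetric in \<open>x\<close>, so \<open>\<eta>\<close> is closed.  It also gives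
  \<open>\<theta> = \<theta>(\<xi>) \<eta>\<close> and \<open>\<theta>\<^sup>* = \<theta>\<^sup>*(\<xi>) \<eta>\<close>, so closedness of \<open>\<theta>\<close> and \<open>\<theta>\<^sup>*\<close> forces \<open>da = \<xi>(a) \<eta>\<close> and
  \<open>db = \<xi>(b) \<eta>\<close>.  For \<open>\<lambda> = \<mu> = 0\<close> the connection is
  \<open>\<nabla>\<^sup>0\<^sub>x y = \<nabla>\<^sub>x y + g(\<nabla>\<^sub>x \<xi>, y) \<xi> - \<eta>(y) \<nabla>\<^sub>x \<xi>\<close>; it preserves \<open>\<phi>\<close>, \<open>\<xi>\<close>, \<open>\<eta>\<close>, and its curvature
  is that of \<open>\<nabla>\<close> corrected by terms in \<open>R(x, y) \<xi>\<close> and \<open>\<nabla>\<xi>\<close>, as in a Gauss equation.  The remaining terms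
  of \<open>\<nabla>'\<close> have the form \<open>\<eta> \<otimes> S\<close> and leave the curvature unchanged.

  Tangent vectors are derivations and traces are formed with vector field extensions and a basis
  of \<open>ker \<eta>\<close>; that these exist rests on Hadamard's lemma and bump functions.
\<close>

section \<open>Calculus of smooth functions\<close>

text \<open>Derivatives at points of an open set depend only on nearby values, so agreement on
  \<open>S\<close> passes to all derivatives. Chart expressions need this because their values
  outside \<open>S\<close> are arbitrary.\<close>

lemma Ck_on_cong:
  assumes "open S" "\<And>x. x \<in> S \<Longrightarrow> f x = h x" "Ck_on k S f"
  shows "Ck_on k S h"
  using assms(2,3)
proof (induction k arbitrary: f h)
  case 0
  then show ?case by (auto intro: continuous_on_eq)
next
  case (Suc k)
  have *: "(h has_derivative frechet_derivative f (at x)) (at x)" if "x \<in> S" for x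
  proof -
    have "(f has_derivative frechet_derivative f (at x)) (at x)"
      using Suc.prems(2) that by (simp add: frechet_derivative_works[symmetric])
    then show ?thesis
      by (rule has_derivative_transform_within_open[OF _ assms(1) that]) (use Suc.prems in auto)
  qed
  have "Ck_on k S (\<lambda>x. frechet_derivative h (at x) v)" for v
  proof (rule Suc.IH)
    show "Ck_on k S (\<lambda>x. frechet_derivative f (at x) v)"
      using Suc.prems by simp
    show "frechet_derivative f (at x) v = frechet_derivative h (at x) v" if "x \<in> S" for x
      using frechet_derivative_at[OF *[OF that]] by simp
  qed
  then show ?case
    using * by (auto simp: differentiable_def)
qed

text \<open>Frees later proofs from the choice made by \<open>frechet_derivative\<close>: any
  explicit formula for the derivative may be used.\<close>

lemma Ck_on_SucI:
  assumes "open S" "\<And>x. x \<in> S \<Longrightarrow> (f has_derivative f' x) (at x)"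
    "\<And>v. Ck_on k S (\<lambda>x. f' x v)"
  shows "Ck_on (Suc k) S f"
proof -
  have "Ck_on k S (\<lambda>x. frechet_derivative f (at x) v)" for v
  proof (rule Ck_on_cong[OF assms(1) _ assms(3)])
    show "f' x v = frechet_derivative f (at x) v" if "x \<in> S" for x
      using frechet_derivative_at[OF assms(2)[OF that]] by simp
  qed
  then show ?thesis
    using assms(2) by (auto simp: differentiable_def)
qed

lemma Ck_on_Suc_has_derivative:
  assumes "Ck_on (Suc k) S f" "x \<in> S"
  shows "(f has_derivative frechet_derivative f (at x)) (at x)"
  using assms by (simp add: frechet_derivative_works[symmetric])

lemma Ck_on_subset:
  assumes "Ck_on k S f" "T \<subseteq> S"
  shows "Ck_on k T f"
  using assms by (induction k arbitrary: f) (auto intro: continuous_on_subset)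

lemma Ck_on_Suc_imp:
  assumes "Ck_on (Suc k) S f"
  shows "Ck_on k S f"
  using assms
proof (induction k arbitrary: f)
  case 0
  then show ?case
    by (auto intro!: continuous_at_imp_continuous_on differentiable_imp_continuous_within)
next
  case (Suc k)
  then show ?case by (auto simp del: Ck_on.simps(2) simp: Ck_on.simps(2)[of "Suc k"] Ck_on.simps(2)[of k])
qed

text \<open>All conditions are local on open sets. The lemma glues a function that is described by
  different expressions on two open sets.\<close>

lemma Ck_on_Un:
  assumes "open S" "open T" "Ck_on k S f" "Ck_on k T f"
  shows "Ck_on k (S \<union> T) f"
  using assms(3,4)
  by (induction k arbitrary: f) (use assms(1,2) in \<open>auto intro: continuous_on_open_Un\<close>)

lemma Ck_on_const: "Ck_on k S (\<lambda>x. a)"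
  by (induction k arbitrary: a) auto

lemma Ck_on_bounded_linear:
  assumes "bounded_linear L" "open S" "Ck_on k S f"
  shows "Ck_on k S (\<lambda>x. L (f x))"
  using assms(3)
proof (induction k arbitrary: f)
  case 0
  then show ?case
    using bounded_linear.continuous_on[OF assms(1)] by simp
next
  case (Suc k)
  show ?case
  proof (rule Ck_on_SucI[OF assms(2)])
    show "((\<lambda>x. L (f x)) has_derivative (\<lambda>v. L (frechet_derivative f (at x) v))) (at x)"
      if "x \<in> S" for x
      by (rule bounded_linear.has_derivative[OF assms(1) Ck_on_Suc_has_derivative[OF Suc.prems that]])
    show "Ck_on k S (\<lambda>x. L (frechet_derivative f (at x) v))" for v
      using Suc.prems by (intro Suc.IH) simp
  qed
qed

lemma Ck_on_ident: "open S \<Longrightarrow> Ck_on k S (\<lambda>x. x)"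
  by (cases k) (auto intro!: Ck_on_SucI[of _ _ "\<lambda>_ v. v"] Ck_on_const simp del: Ck_on.simps(2))

lemma Ck_on_add:
  assumes "open S" "Ck_on k S f" "Ck_on k S h"
  shows "Ck_on k S (\<lambda>x. f x + h x)"
  using assms(2,3)
proof (induction k arbitrary: f h)
  case 0
  then show ?case by (simp add: continuous_on_add)
next
  case (Suc k)
  show ?case
  proof (rule Ck_on_SucI[OF assms(1)])
    fix x assume x: "x \<in> S"
    show "((\<lambda>x. f x + h x) has_derivative
        (\<lambda>v. frechet_derivative f (at x) v + frechet_derivative h (at x) v)) (at x)"
      by (rule has_derivative_add[OF Ck_on_Suc_has_derivative[OF Suc.prems(1) x]
            Ck_on_Suc_has_derivative[OF Suc.prems(2) x]])
  next
    show "Ck_on k S (\<lambda>x. frechet_derivative f (at x) v + frechet_derivative h (at x) v)" for v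
      using Suc.prems by (intro Suc.IH) auto
  qed
qed

lemma Ck_on_mult:
  fixes f h :: "'e::real_normed_vector \<Rightarrow> real"
  assumes "open S" "Ck_on k S f" "Ck_on k S h"
  shows "Ck_on k S (\<lambda>x. f x * h x)"
  using assms(2,3)
proof (induction k arbitrary: f h)
  case 0
  then show ?case by (simp add: continuous_on_mult)
next
  case (Suc k)
  show ?case
  proof (rule Ck_on_SucI[OF assms(1)])
    fix x assume x: "x \<in> S"
    show "((\<lambda>x. f x * h x) has_derivative
        (\<lambda>v. f x * frechet_derivative h (at x) v + frechet_derivative f (at x) v * h x)) (at x)"
      by (rule has_derivative_mult[OF Ck_on_Suc_has_derivative[OF Suc.prems(1) x]
            Ck_on_Suc_has_derivative[OF Suc.prems(2) x]])
  next
    show "Ck_on k S (\<lambda>x. f x * frechet_derivative h (at x) v + frechet_derivative f (at x) v * h x)"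
      for v
    proof (rule Ck_on_add[OF assms(1)])
      show "Ck_on k S (\<lambda>x. f x * frechet_derivative h (at x) v)"
        by (rule Suc.IH[OF Ck_on_Suc_imp[OF Suc.prems(1)]]) (use Suc.prems in simp)
      show "Ck_on k S (\<lambda>x. frechet_derivative f (at x) v * h x)"
        by (rule Suc.IH[OF _ Ck_on_Suc_imp[OF Suc.prems(2)]]) (use Suc.prems in simp)
    qed
  qed
qed

lemma Ck_on_sum:
  assumes "open S" "\<And>i. i \<in> I \<Longrightarrow> Ck_on k S (f i)"
  shows "Ck_on k S (\<lambda>x. \<Sum>i\<in>I. f i x)"
  using assms(2)
  by (induction I rule: infinite_finite_induct) (simp_all add: Ck_on_const Ck_on_add assms(1))

text \<open>Turns a derivative in a varying direction into a combination of derivatives in fixed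
  directions.\<close>

lemma has_derivative_eq_sum_Basis:
  fixes h :: "'e::euclidean_space \<Rightarrow> real"
  assumes "(h has_derivative h') F"
  shows "h' w = (\<Sum>b\<in>Basis. (w \<bullet> b) * h' b)"
proof -
  have "linear h'" using has_derivative_linear[OF assms] .
  have "h' w = h' (\<Sum>b\<in>Basis. (w \<bullet> b) *\<^sub>R b)"
    by (simp only: euclidean_representation)
  also have "\<dots> = (\<Sum>b\<in>Basis. (w \<bullet> b) * h' b)"
    by (simp only: linear_sum[OF \<open>linear h'\<close>] linear_scale[OF \<open>linear h'\<close>] real_scaleR_def)
  finally show ?thesis .
qed

text \<open>The chain rule applies the derivative of \<open>h\<close> to the moving vector
  \<open>?f' x v\<close>, whereas \<open>Ck_on\<close> speaks of fixed directions. Expansion in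
  \<open>Basis\<close> leaves products to which the induction hypothesis for \<open>h\<close>
  applies.\<close>

lemma Ck_on_compose:
  fixes h :: "'f::euclidean_space \<Rightarrow> real" and f :: "'e::real_normed_vector \<Rightarrow> 'f"
  assumes "open S" "open T" "f ` S \<subseteq> T" "Ck_on k S f" "Ck_on k T h"
  shows "Ck_on k S (\<lambda>x. h (f x))"
  using assms(4,5)
proof (induction k arbitrary: h)
  case 0
  then show ?case
    using continuous_on_compose2[of T h S f] assms(3) by simp
next
  case (Suc k)
  let ?f' = "\<lambda>x. frechet_derivative f (at x)" and ?h' = "\<lambda>y. frechet_derivative h (at y)"
  show ?case
  proof (rule Ck_on_SucI[OF assms(1)])
    show "((\<lambda>x. h (f x)) has_derivative (\<lambda>v. \<Sum>b\<in>Basis. (?f' x v \<bullet> b) * ?h' (f x) b)) (at x)"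
      if "x \<in> S" for x
    proof -
      have f: "f x \<in> T" using assms(3) that by auto
      have h': "(h has_derivative ?h' (f x)) (at (f x))"
        by (rule Ck_on_Suc_has_derivative[OF Suc.prems(2) f])
      have "((\<lambda>x. h (f x)) has_derivative (\<lambda>v. ?h' (f x) (?f' x v))) (at x)"
        by (rule has_derivative_compose[OF Ck_on_Suc_has_derivative[OF Suc.prems(1) that] h'])
      then show ?thesis
        by (rule has_derivative_eq_rhs[OF _ ext]) (rule has_derivative_eq_sum_Basis[OF h'])
    qed
    show "Ck_on k S (\<lambda>x. \<Sum>b\<in>Basis. (?f' x v \<bullet> b) * ?h' (f x) b)" for v
    proof (rule Ck_on_sum[OF assms(1)], rule Ck_on_mult[OF assms(1)])
      fix b :: 'f
      show "Ck_on k S (\<lambda>x. ?f' x v \<bullet> b)"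
        by (rule Ck_on_bounded_linear[OF bounded_linear_inner_left assms(1)]) (use Suc.prems(1) in simp)
      show "Ck_on k S (\<lambda>x. ?h' (f x) b)"
        by (rule Suc.IH[OF Ck_on_Suc_imp[OF Suc.prems(1)]]) (use Suc.prems(2) in simp)
    qed
  qed
qed

section \<open>Smooth bump functions on Euclidean space\<close>

text \<open>The family of all \<open>p(1/s) exp(-1/s)\<close>, extended by \<open>0\<close> to \<open>s \<le> 0\<close>, is closed under derivatives.\<close>

definition flat_fun :: "real poly \<Rightarrow> real \<Rightarrow> real" where
  "flat_fun p s = (if s > 0 then poly p (1/s) * exp (-(1/s)) else 0)"

lemma poly_mult_exp_tendsto_0: "((\<lambda>y. poly p y * exp (-y)) \<longlongrightarrow> 0) at_top" for p :: "real poly"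
proof -
  have "((\<lambda>y. \<Sum>i\<le>degree p. coeff p i * (y ^ i / exp y)) \<longlongrightarrow> (\<Sum>i\<le>degree p. coeff p i * 0)) at_top"
    by (intro tendsto_intros tendsto_power_div_exp_0)
  moreover have "(\<Sum>i\<le>degree p. coeff p i * (y ^ i / exp y)) = poly p y * exp (-y)" for y
    unfolding poly_altdef sum_distrib_right exp_minus divide_inverse mult.assoc ..
  ultimately show ?thesis by simp
qed

lemma flat_fun_tendsto_0: "(flat_fun p \<longlongrightarrow> 0) (at_right 0)"
proof -
  have "((\<lambda>s. poly p (1/s) * exp (-(1/s))) \<longlongrightarrow> 0) (at_right 0)"
    using filterlim_compose[OF poly_mult_exp_tendsto_0[of p] filterlim_inverse_at_top_right]
    by (simp add: inverse_eq_divide)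
  then show ?thesis
    by (rule Lim_transform_eventually)
      (auto simp: flat_fun_def eventually_at_right_field intro: exI[of _ 1])
qed

text \<open>With y = 1/s, the derivative of p(y) exp(-y) with respect to s is y^2 (p - p')(y)
  exp(-y). Only \<open>s = 0\<close> needs a separate limit argument.\<close>

lemma flat_fun_deriv:
  "(flat_fun p has_real_derivative flat_fun (monom 1 2 * (p - pderiv p)) s) (at s)"
proof -
  consider "s > 0" | "s < 0" | "s = 0" by linarith
  then show ?thesis
  proof cases
    case 1
    have "((\<lambda>s. poly p (1/s) * exp (-(1/s))) has_real_derivative
        flat_fun (monom 1 2 * (p - pderiv p)) s) (at s)"
      using 1 by (auto intro!: derivative_eq_intros
          simp: flat_fun_def poly_monom power2_eq_square divide_simps)
        (simp add: algebra_simps)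
    then show ?thesis
      by (rule has_field_derivative_transform_within_open[of _ _ _ "{0<..}"])
        (use 1 in \<open>auto simp: flat_fun_def\<close>)
  next
    case 2
    have "((\<lambda>_. 0) has_real_derivative flat_fun (monom 1 2 * (p - pderiv p)) s) (at s)"
      using 2 by (simp add: flat_fun_def)
    then show ?thesis
      by (rule has_field_derivative_transform_within_open[of _ _ _ "{..<0}"])
        (use 2 in \<open>auto simp: flat_fun_def\<close>)
  next
    case 3
    \<comment> \<open>Division by \<open>h\<close> multiplies the polynomial in 1/h by its variable,
      so the quotient is again a flat function.\<close>
    have "((\<lambda>h. flat_fun p h / h) \<longlongrightarrow> 0) (at_right 0)"
    proof (rule Lim_transform_eventually[OF flat_fun_tendsto_0[of "monom 1 1 * p"]])
      show "\<forall>\<^sub>F h in at_right 0. flat_fun (monom 1 1 * p) h = flat_fun p h / h"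
        by (auto simp: flat_fun_def poly_monom)
    qed
    moreover have "((\<lambda>h. flat_fun p h / h) \<longlongrightarrow> 0) (at_left 0)"
      by (rule tendsto_eventually) (auto simp: flat_fun_def eventually_at_left_field intro: exI[of _ "-1"])
    ultimately have "((\<lambda>h. flat_fun p h / h) \<longlongrightarrow> 0) (at 0)"
      using filterlim_split_at by blast
    then show ?thesis
      using 3 by (simp add: DERIV_def flat_fun_def)
  qed
qed

lemma Ck_on_flat_fun: "Ck_on k UNIV (flat_fun p)"
proof (induction k arbitrary: p)
  case 0
  show ?case
    using DERIV_isCont[OF flat_fun_deriv] by (auto intro!: continuous_at_imp_continuous_on)
next
  case (Suc k)
  show ?case
  proof (rule Ck_on_SucI)
    let ?q = "monom 1 2 * (p - pderiv p)"
    show "(flat_fun p has_derivative (\<lambda>v. v * flat_fun ?q s)) (at s)" for s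
      using flat_fun_deriv[of p s] by (simp add: has_field_derivative_def mult_commute_abs)
    show "Ck_on k UNIV (\<lambda>s. v * flat_fun ?q s)" for v
      by (intro Ck_on_mult Ck_on_const Suc.IH) simp
  qed simp
qed

lemma ex_bump_fun:
  fixes x0 :: "'e::euclidean_space"
  assumes "r > 0"
  shows "\<exists>\<rho>::'e \<Rightarrow> real. Cinf_on UNIV \<rho> \<and> \<rho> x0 = 1 \<and> (\<forall>x. x \<notin> cball x0 r \<longrightarrow> \<rho> x = 0)"
proof (intro exI conjI allI impI)
  \<comment> \<open>The squared distance is written in coordinates so that the closure rules for
    sums and products apply.\<close>
  let ?s = "\<lambda>x. r\<^sup>2 - (\<Sum>b\<in>Basis. ((x - x0) \<bullet> b) * ((x - x0) \<bullet> b))"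
  \<comment> \<open>The constant normalises the value at \<open>x0\<close>, where the argument of
    \<open>flat_fun\<close> is \<open>r\<^sup>2\<close>; outside the closed ball that argument is
    negative.\<close>
  let ?\<rho> = "\<lambda>x. exp (1 / r\<^sup>2) * flat_fun 1 (?s x)"
  have s: "?s x = r\<^sup>2 - (dist x0 x)\<^sup>2" for x
    by (simp add: dist_norm norm_minus_commute[of x0] flip: euclidean_inner power2_norm_eq_inner)
  have b: "Ck_on k UNIV (\<lambda>x. (x - x0) \<bullet> b)" for k and b :: 'e
    using Ck_on_add[OF open_UNIV Ck_on_ident[OF open_UNIV] Ck_on_const[of _ _ "-x0"]]
    by (intro Ck_on_bounded_linear[OF bounded_linear_inner_left open_UNIV]) simp
  have "Ck_on k UNIV (\<lambda>x. r\<^sup>2 + (-1) * (\<Sum>b\<in>Basis. ((x - x0) \<bullet> b) * ((x - x0) \<bullet> b)))" for k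
    by (intro Ck_on_add Ck_on_mult Ck_on_sum Ck_on_const b open_UNIV)
  then have "Ck_on k UNIV ?s" for k by simp
  then have "Ck_on k UNIV ?\<rho>" for k
    by (intro Ck_on_mult Ck_on_const Ck_on_compose[OF _ open_UNIV _ _ Ck_on_flat_fun]) auto
  then show "Cinf_on UNIV ?\<rho>" by (simp add: Cinf_on_def)
  show "?\<rho> x0 = 1"
    using assms by (simp add: flat_fun_def flip: exp_add)
  show "?\<rho> x = 0" if "x \<notin> cball x0 r" for x
  proof -
    have "r\<^sup>2 < (dist x0 x)\<^sup>2"
      using that assms by (intro power_strict_mono) auto
    then show ?thesis by (simp only: s) (simp add: flat_fun_def)
  qed
qed

section \<open>Hadamard's lemma\<close>

text \<open>Differentiation under the integral replaces \<open>H\<close> by a directional derivative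
  and, by the chain rule, adds a factor \<open>t\<close>. The weight \<open>t ^ j\<close> with
  arbitrary \<open>j\<close> makes the statement stable under this step.\<close>

lemma Ck_on_segment_integral:
  fixes H :: "'e::euclidean_space \<Rightarrow> real"
  assumes "open U" "convex U" "x0 \<in> U" "Ck_on k U H"
  shows "Ck_on k U (\<lambda>x. integral {0..1} (\<lambda>t. t ^ j * H (x0 + t *\<^sub>R (x - x0))))"
  using assms(4)
proof (induction k arbitrary: H j)
  have seg: "x0 + t *\<^sub>R (x - x0) \<in> U" if "x \<in> U" "t \<in> {0..1}" for x and t :: real
  proof -
    have "(1 - t) *\<^sub>R x0 + t *\<^sub>R x \<in> U"
      using that assms(2,3) by (auto intro: convexD)
    then show ?thesis by (simp add: algebra_simps)
  qed
  have cont: "continuous_on (U \<times> cbox 0 1) (\<lambda>(x, t). t ^ j * H (x0 + t *\<^sub>R (x - x0)))"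
    if "continuous_on U H" for H :: "'e \<Rightarrow> real" and j
  proof -
    have "continuous_on (U \<times> {0..1}) (\<lambda>z. H (x0 + snd z *\<^sub>R (fst z - x0)))"
      by (rule continuous_on_compose2[OF that]) (use seg in \<open>auto intro!: continuous_intros\<close>)
    then show ?thesis
      unfolding split_beta by (auto intro!: continuous_intros)
  qed
  {
    case 0
    then show ?case
      using integral_continuous_on_param[OF cont[of H j]] by simp
  next
    case (Suc k)
    let ?H' = "\<lambda>x. frechet_derivative H (at x)" and ?p = "\<lambda>x t. x0 + t *\<^sub>R (x - x0)"
    have H': "(H has_derivative ?H' x) (at x)" if "x \<in> U" for x
      by (rule Ck_on_Suc_has_derivative[OF Suc.prems that])
    have H'k: "Ck_on k U (\<lambda>x. ?H' x v)" for v
      using Suc.prems by simp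
    have H_cont: "continuous_on U H"
      using H' by (meson continuous_at_imp_continuous_on has_derivative_continuous)
    \<comment> \<open>The derivative of the integrand in \<open>x\<close>, packaged as a bounded
      linear map because \<open>leibniz_rule\<close> asks for one that is jointly
      continuous.\<close>
    define fx where "fx x t = (\<Sum>b\<in>Basis. (t ^ Suc j * ?H' (?p x t) b) *\<^sub>R blinfun_inner_left b)" for x t
    have fx: "blinfun_apply (fx x t) v = t ^ Suc j * ?H' (?p x t) v" if "x \<in> U" "t \<in> {0..1}" for x t v
      unfolding has_derivative_eq_sum_Basis[OF H'[OF seg[OF that]], of v]
      by (simp add: fx_def blinfun.sum_left blinfun.scaleR_left sum_distrib_left mult_ac inner_commute)
    have H'c: "continuous_on U (\<lambda>x. ?H' x b)" for b
    proof -
      have "Ck_on 0 U (\<lambda>x. ?H' x b)"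
        using H'k[of b] by (induction k) (auto dest: Ck_on_Suc_imp simp del: Ck_on.simps)
      then show ?thesis by simp
    qed
    have fx_cont: "continuous_on (U \<times> cbox 0 1) (\<lambda>(x, t). fx x t)"
      using cont[OF H'c, of "Suc j"] unfolding fx_def split_beta
      by (intro continuous_on_sum continuous_on_scaleR continuous_on_const)
    have int: "(\<lambda>t. t ^ i * h (?p x t)) integrable_on cbox 0 1"
      if "x \<in> U" "continuous_on U h" for x and h :: "'e \<Rightarrow> real" and i
      by (rule integrable_continuous) (rule continuous_on_compose2[OF cont[OF that(2)],
          of _ "\<lambda>t. (x, t)", unfolded split_beta fst_conv snd_conv],
        use that(1) in \<open>auto intro!: continuous_intros\<close>)
    show ?case
    proof (rule Ck_on_SucI[OF assms(1)])
      show "Ck_on k U (\<lambda>x. integral {0..1} (\<lambda>t. t ^ Suc j * ?H' (?p x t) v))" for v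
        by (rule Suc.IH[OF H'k])
      fix x assume x: "x \<in> U"
      have "((\<lambda>x. integral (cbox 0 1) (\<lambda>t. t ^ j * H (?p x t)))
          has_derivative blinfun_apply (integral (cbox 0 1) (fx x))) (at x within U)"
      proof (rule leibniz_rule[OF _ _ fx_cont x assms(2)])
        show "((\<lambda>x. t ^ j * H (?p x t)) has_derivative blinfun_apply (fx x t)) (at x within U)"
          if "x \<in> U" "t \<in> cbox 0 1" for x and t :: real
        proof -
          have t: "t \<in> {0..1}" using that by simp
          have "((\<lambda>x. H (?p x t)) has_derivative (\<lambda>v. ?H' (?p x t) (t *\<^sub>R v))) (at x within U)"
            by (rule has_derivative_compose[of "\<lambda>x. ?p x t", OF _ H'[OF seg[OF that(1) t]]])
              (auto intro!: derivative_eq_intros)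
          then have "((\<lambda>x. t ^ j * H (?p x t)) has_derivative
              (\<lambda>v. t ^ j * ?H' (?p x t) (t *\<^sub>R v))) (at x within U)"
            by (rule has_derivative_mult_right)
          moreover have "t ^ j * ?H' (?p x t) (t *\<^sub>R v) = blinfun_apply (fx x t) v" for v
            using linear_scale[OF has_derivative_linear[OF H'[OF seg[OF that(1) t]]]]
            by (simp add: fx[OF that(1) t] mult_ac)
          ultimately show ?thesis
            by (rule has_derivative_eq_rhs[OF _ ext])
        qed
        show "(\<lambda>t. t ^ j * H (?p x t)) integrable_on cbox 0 1" if "x \<in> U" for x
          by (rule int[OF that H_cont])
      qed
      moreover have "blinfun_apply (integral (cbox 0 1) (fx x)) v =
          integral {0..1} (\<lambda>t. t ^ Suc j * ?H' (?p x t) v)" for v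
      proof -
        have "fx x integrable_on cbox 0 1"
          by (rule integrable_continuous) (rule continuous_on_compose2[OF fx_cont,
              of _ "\<lambda>t. (x, t)", unfolded split_beta fst_conv snd_conv],
            use x in \<open>auto intro!: continuous_intros\<close>)
        then have "blinfun_apply (integral (cbox 0 1) (fx x)) v =
            integral (cbox 0 1) (\<lambda>t. blinfun_apply (fx x t) v)"
          by (rule blinfun_apply_integral)
        also have "\<dots> = integral {0..1} (\<lambda>t. t ^ Suc j * ?H' (?p x t) v)"
          by (simp only: cbox_interval) (rule integral_cong, rule fx[OF x])
        finally show ?thesis .
      qed
      ultimately have "((\<lambda>x. integral (cbox 0 1) (\<lambda>t. t ^ j * H (?p x t)))
          has_derivative (\<lambda>v. integral {0..1} (\<lambda>t. t ^ Suc j * ?H' (?p x t) v))) (at x within U)"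
        by (rule has_derivative_eq_rhs[OF _ ext])
      then show "((\<lambda>x. integral {0..1} (\<lambda>t. t ^ j * H (?p x t)))
          has_derivative (\<lambda>v. integral {0..1} (\<lambda>t. t ^ Suc j * ?H' (?p x t) v))) (at x)"
        using at_within_open[OF x assms(1)] by simp
    qed
  }
qed

text \<open>By the fundamental theorem of calculus along the segment from \<open>x0\<close> to
  \<open>x\<close>, the function \<open>G b\<close> is the mean over that segment of the partial
  derivative of \<open>F\<close> in direction \<open>b\<close>.\<close>

lemma Hadamard:
  fixes F :: "'e::euclidean_space \<Rightarrow> real"
  assumes "open U" "convex U" "x0 \<in> U" "Cinf_on U F"
  shows "\<exists>G. (\<forall>b. Cinf_on U (G b) \<and> G b x0 = frechet_derivative F (at x0) b) \<and>
    (\<forall>x\<in>U. F x = F x0 + (\<Sum>b\<in>Basis. ((x - x0) \<bullet> b) * G b x))"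
proof (intro exI conjI allI ballI)
  let ?F' = "\<lambda>x. frechet_derivative F (at x)"
  \<comment> \<open>The factor \<open>t ^ 0\<close> matches the weighted integral of
    \<open>Ck_on_segment_integral\<close> at \<open>j = 0\<close>.\<close>
  let ?G = "\<lambda>b x. integral {0..1} (\<lambda>t. t ^ 0 * ?F' (x0 + t *\<^sub>R (x - x0)) b)"
  have F: "Ck_on (Suc k) U F" for k
    using assms(4) unfolding Cinf_on_def by blast
  have F'k: "Ck_on k U (\<lambda>x. ?F' x b)" for k b
    using F[of k] by simp
  show "Cinf_on U (?G b)" for b
    unfolding Cinf_on_def using Ck_on_segment_integral[OF assms(1-3) F'k] by blast
  show "?G b x0 = ?F' x0 b" for b
    by simp
  show "F x = F x0 + (\<Sum>b\<in>Basis. ((x - x0) \<bullet> b) * ?G b x)" if x: "x \<in> U" for x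
  proof -
    have seg: "x0 + t *\<^sub>R (x - x0) \<in> U" if "t \<in> {0..1}" for t :: real
    proof -
      have "(1 - t) *\<^sub>R x0 + t *\<^sub>R x \<in> U"
        using that x assms(2,3) by (auto intro: convexD)
      then show ?thesis by (simp add: algebra_simps)
    qed
    have *: "((\<lambda>t. F (x0 + t *\<^sub>R (x - x0))) has_vector_derivative
        (\<Sum>b\<in>Basis. ((x - x0) \<bullet> b) * ?F' (x0 + t *\<^sub>R (x - x0)) b)) (at t within {0..1})"
      if "t \<in> {0..1}" for t
    proof -
      note F' = Ck_on_Suc_has_derivative[OF F[of 0] seg[OF that]]
      have "((\<lambda>t. F (x0 + t *\<^sub>R (x - x0))) has_derivative
          (\<lambda>s. ?F' (x0 + t *\<^sub>R (x - x0)) (s *\<^sub>R (x - x0)))) (at t within {0..1})"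
        by (rule has_derivative_compose[of "\<lambda>t. x0 + t *\<^sub>R (x - x0)", OF _ F'])
            (auto intro!: derivative_eq_intros)
      then show ?thesis
        unfolding has_vector_derivative_def
        by (rule has_derivative_eq_rhs)
          (simp add: linear_scale[OF has_derivative_linear[OF F']] fun_eq_iff
            flip: has_derivative_eq_sum_Basis[OF F'])
    qed
    have "((\<lambda>t. \<Sum>b\<in>Basis. ((x - x0) \<bullet> b) * ?F' (x0 + t *\<^sub>R (x - x0)) b) has_integral F x - F x0) {0..1}"
      using fundamental_theorem_of_calculus[OF _ *] by simp
    then have "F x - F x0 =
        integral {0..1} (\<lambda>t. \<Sum>b\<in>Basis. ((x - x0) \<bullet> b) * ?F' (x0 + t *\<^sub>R (x - x0)) b)"
      by (simp add: integral_unique)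
    also have "\<dots> = (\<Sum>b\<in>Basis. ((x - x0) \<bullet> b) * ?G b x)"
    proof -
      have "continuous_on {0..1} (\<lambda>t. ?F' (x0 + t *\<^sub>R (x - x0)) b)" for b
        by (rule continuous_on_compose2[where g="\<lambda>x. ?F' x b" and t=U])
          (use F'k[of 0 b] seg in \<open>auto intro!: continuous_intros\<close>)
      then have "(\<lambda>t. ((x - x0) \<bullet> b) * ?F' (x0 + t *\<^sub>R (x - x0)) b) integrable_on {0..1}" for b
        by (intro integrable_continuous_interval continuous_intros) auto
      then show ?thesis
        by (simp add: integral_sum)
    qed
    finally show ?thesis by simp
  qed
qed

section \<open>Tangent spaces of smooth manifolds\<close>

lemma tangent_space_add: "v \<in> tangent_space A p \<Longrightarrow> w \<in> tangent_space A p \<Longrightarrow> v + w \<in> tangent_space A p"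
  by (simp add: tangent_space_def algebra_simps)

lemma tangent_space_scale: "v \<in> tangent_space A p \<Longrightarrow> r *\<^sub>R v \<in> tangent_space A p"
  by (simp add: tangent_space_def algebra_simps)

lemma tangent_space_0: "0 \<in> tangent_space A p"
  by (simp add: tangent_space_def)

lemma tangent_space_uminus: "v \<in> tangent_space A p \<Longrightarrow> - v \<in> tangent_space A p"
  using tangent_space_scale[of v A p "-1"] by simp

lemma tangent_space_diff: "v \<in> tangent_space A p \<Longrightarrow> w \<in> tangent_space A p \<Longrightarrow> v - w \<in> tangent_space A p"
  using tangent_space_add[OF _ tangent_space_uminus, of v A p w] by simp

lemmas tangent_space_intros =
  tangent_space_add tangent_space_scale tangent_space_0 tangent_space_uminus tangent_space_diff

lemma tangent_vector_add:
  "v \<in> tangent_space A p \<Longrightarrow> smooth_fun A f \<Longrightarrow> smooth_fun A h \<Longrightarrow> v (\<lambda>q. f q + h q) = v f + v h"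
  by (simp add: tangent_space_def)

lemma tangent_vector_scale:
  "v \<in> tangent_space A p \<Longrightarrow> smooth_fun A f \<Longrightarrow> v (\<lambda>q. r * f q) = r * v f"
  by (simp add: tangent_space_def)

lemma tangent_vector_mult:
  "v \<in> tangent_space A p \<Longrightarrow> smooth_fun A f \<Longrightarrow> smooth_fun A h \<Longrightarrow>
    v (\<lambda>q. f q * h q) = v f * h p + f p * v h"
  by (simp add: tangent_space_def)

section \<open>Charts and smooth functions on the manifold\<close>

locale smooth_manifold =
  fixes A :: "('a::{t2_space,second_countable_topology}, 'e::euclidean_space) atlas"
  assumes smooth_atlas: "smooth_atlas A"
begin

lemma ex_chart: "\<exists>U c. (U, c) \<in> A \<and> p \<in> U"
proof -
  have "p \<in> (\<Union>(U, c)\<in>A. U)" using smooth_atlas unfolding smooth_atlas_def by simp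
  then show ?thesis by auto
qed

lemma chart:
  assumes "(U, c) \<in> A"
  shows "open U" "open (c ` U)" "homeomorphism U (c ` U) c (inv_into U c)"
  using smooth_atlas assms unfolding smooth_atlas_def by auto

lemma chart_inv [simp]: "(U, c) \<in> A \<Longrightarrow> q \<in> U \<Longrightarrow> inv_into U c (c q) = q"
  using chart(3) by (rule homeomorphism_apply1)

lemma chart_transition:
  "(U, c) \<in> A \<Longrightarrow> (V, d) \<in> A \<Longrightarrow> Cinf_on (c ` (U \<inter> V)) (d \<circ> inv_into U c)"
  using smooth_atlas unfolding smooth_atlas_def by blast

lemma open_chart_image: "(U, c) \<in> A \<Longrightarrow> open W \<Longrightarrow> W \<subseteq> U \<Longrightarrow> open (c ` W)"
  using homeomorphism_imp_open_map[OF chart(3)] chart(2)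
  by (metis chart(1) open_openin_trans openin_open_eq)

lemma smooth_fun_local: "(U, c) \<in> A \<Longrightarrow> smooth_fun A f \<Longrightarrow> Ck_on k (c ` U) (f \<circ> inv_into U c)"
  by (auto simp: smooth_fun_def Cinf_on_def)

lemma smooth_fun_const: "smooth_fun A (\<lambda>q. r)"
  by (auto simp: smooth_fun_def Cinf_on_def comp_def Ck_on_const)

lemma smooth_fun_add: "smooth_fun A f \<Longrightarrow> smooth_fun A h \<Longrightarrow> smooth_fun A (\<lambda>q. f q + h q)"
  by (auto simp: smooth_fun_def Cinf_on_def comp_def intro!: Ck_on_add chart(2))

lemma smooth_fun_mult: "smooth_fun A f \<Longrightarrow> smooth_fun A h \<Longrightarrow> smooth_fun A (\<lambda>q. f q * h q)"
  by (auto simp: smooth_fun_def Cinf_on_def comp_def intro!: Ck_on_mult chart(2))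

lemma smooth_fun_sum:
  "(\<And>i. i \<in> I \<Longrightarrow> smooth_fun A (f i)) \<Longrightarrow> smooth_fun A (\<lambda>q. \<Sum>i\<in>I. f i q)"
  by (induction I rule: infinite_finite_induct) (simp_all add: smooth_fun_const smooth_fun_add)

lemma smooth_fun_uminus: "smooth_fun A f \<Longrightarrow> smooth_fun A (\<lambda>q. - f q)"
  using smooth_fun_mult[OF smooth_fun_const[of "-1"]] by simp

lemma smooth_fun_diff: "smooth_fun A f \<Longrightarrow> smooth_fun A h \<Longrightarrow> smooth_fun A (\<lambda>q. f q - h q)"
  using smooth_fun_add[OF _ smooth_fun_uminus, of f h] by simp

lemmas smooth_fun_intros =
  smooth_fun_const smooth_fun_add smooth_fun_mult smooth_fun_uminus smooth_fun_diff

text \<open>The Leibniz rule for 1 = 1 * 1 gives v(1) = 2 v(1).\<close>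

lemma tangent_vector_const:
  assumes "v \<in> tangent_space A p"
  shows "v (\<lambda>q. r) = 0"
proof -
  have "v (\<lambda>q. 1 * 1) = v (\<lambda>q. 1) * 1 + 1 * v (\<lambda>q. 1)"
    by (rule tangent_vector_mult[OF assms]) (rule smooth_fun_const)+
  moreover have "v (\<lambda>q. r * 1) = r * v (\<lambda>q. 1)"
    by (rule tangent_vector_scale[OF assms]) (rule smooth_fun_const)
  ultimately show ?thesis by simp
qed

lemma tangent_vector_uminus: "v \<in> tangent_space A p \<Longrightarrow> smooth_fun A f \<Longrightarrow> v (\<lambda>q. - f q) = - v f"
  using tangent_vector_scale[of v A p f "-1"] by simp

lemma tangent_vector_diff:
  "v \<in> tangent_space A p \<Longrightarrow> smooth_fun A f \<Longrightarrow> smooth_fun A h \<Longrightarrow> v (\<lambda>q. f q - h q) = v f - v h"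
  using tangent_vector_add[OF _ _ smooth_fun_uminus, of v p f h] tangent_vector_uminus[of v p h] by simp

lemma tangent_vector_sum:
  assumes "v \<in> tangent_space A p" "\<And>i. i \<in> I \<Longrightarrow> smooth_fun A (f i)"
  shows "v (\<lambda>q. \<Sum>i\<in>I. f i q) = (\<Sum>i\<in>I. v (f i))"
  using assms(2)
  by (induction I rule: infinite_finite_induct)
    (simp_all add: tangent_vector_const[OF assms(1)] tangent_vector_add[OF assms(1)] smooth_fun_sum)

text \<open>The preimage of \<open>K\<close> is compact, hence closed because the manifold is
  Hausdorff. So any chart domain \<open>V\<close> is covered by two open sets:
  \<open>V - K'\<close>, where the function is 0, and \<open>V \<inter> U\<close>, where it is
  \<open>h\<close> composed with a transition map.\<close>

lemma smooth_fun_zero_extension: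
  assumes U: "(U, c) \<in> A" and h: "Cinf_on (c ` U) h"
    and K: "compact K" "K \<subseteq> c ` U" "\<And>x. x \<in> c ` U - K \<Longrightarrow> h x = 0"
  shows "smooth_fun A (\<lambda>q. if q \<in> U then h (c q) else 0)" (is "smooth_fun A ?f")
proof -
  have "Ck_on k (d ` V) (?f \<circ> inv_into V d)" if V: "(V, d) \<in> A" for V d k
  proof -
    define K' where "K' = inv_into U c ` K"
    have "compact K'"
      unfolding K'_def using K(1,2) homeomorphism_cont2[OF chart(3)[OF U]]
      by (blast intro: compact_continuous_image continuous_on_subset)
    then have "open (V - K')"
      using chart(1)[OF V] by (simp add: compact_imp_closed open_Diff)
    then have open1: "open (d ` (V - K'))"
      by (rule open_chart_image[OF V]) simp
    have open2: "open (d ` (V \<inter> U))"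
      by (rule open_chart_image[OF V]) (use chart(1) U V in auto)
    have K'U: "K' \<subseteq> U"
      using K(2) by (auto simp: K'_def intro: inv_into_into)
    have "Ck_on k (d ` (V - K')) (?f \<circ> inv_into V d)"
    proof (rule Ck_on_cong[OF open1 _ Ck_on_const[of _ _ 0]])
      fix y assume "y \<in> d ` (V - K')"
      then obtain q where q: "q \<in> V" "q \<notin> K'" "y = d q" by auto
      have "h (c q) = 0" if "q \<in> U"
        using K(3)[of "c q"] q(2) that U by (force simp: K'_def)
      then show "0 = (?f \<circ> inv_into V d) y"
        using q V by simp
    qed
    moreover have "Ck_on k (d ` (V \<inter> U)) (?f \<circ> inv_into V d)"
    proof (rule Ck_on_cong[OF open2])
      show "Ck_on k (d ` (V \<inter> U)) (\<lambda>y. h ((c \<circ> inv_into V d) y))"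
        by (rule Ck_on_compose[OF open2 chart(2)[OF U]])
          (use chart_transition[OF V U] h V in \<open>auto simp: Cinf_on_def comp_def\<close>)
      show "h ((c \<circ> inv_into V d) y) = (?f \<circ> inv_into V d) y" if "y \<in> d ` (V \<inter> U)" for y
        using that V by auto
    qed
    moreover have "d ` (V - K') \<union> d ` (V \<inter> U) = d ` V"
      using K'U by auto
    ultimately show ?thesis
      using Ck_on_Un[OF open1 open2] by metis
  qed
  then show ?thesis
    by (auto simp: smooth_fun_def Cinf_on_def)
qed

end

section \<open>Coordinate vector fields around a point, cut off by a bump function\<close>

text \<open>The gap between \<open>r\<close> and \<open>R\<close> makes the open ball of radius
  \<open>R\<close> and the complement of the closed ball of radius \<open>r\<close> an open cover of
  the chart image.\<close>

locale bump_chart = smooth_manifold A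
  for A :: "('a::{t2_space,second_countable_topology}, 'e::euclidean_space) atlas" +
  fixes U :: "'a set" and c :: "'a \<Rightarrow> 'e" and p :: 'a and R r :: real and \<rho> :: "'e \<Rightarrow> real"
  assumes chart_in_atlas: "(U, c) \<in> A" and p_in_U: "p \<in> U"
    and radii: "0 < r" "r < R" and ball_subset: "ball (c p) R \<subseteq> c ` U"
    and bump: "Cinf_on UNIV \<rho>" "\<rho> (c p) = 1" "\<And>x. x \<notin> cball (c p) r \<Longrightarrow> \<rho> x = 0"
begin

definition bump_ext :: "('e \<Rightarrow> real) \<Rightarrow> 'a \<Rightarrow> real" where
  "bump_ext h q = (if q \<in> U then \<rho> (c q) * h (c q) else 0)"

text \<open>The derivative in the constant direction \<open>w\<close>, damped by \<rho> to become
  global. The value 0 at non-smooth \<open>f\<close> follows the convention of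
  \<open>tangent_space\<close>.\<close>

definition coord_field :: "'e \<Rightarrow> 'a vfield" where
  "coord_field w q f = (if smooth_fun A f
     then bump_ext (\<lambda>x. frechet_derivative (f \<circ> inv_into U c) (at x) w) q else 0)"

lemma bump_ext_at_p [simp]: "bump_ext h p = h (c p)"
  using p_in_U bump by (simp add: bump_ext_def)

text \<open>Smoothness of \<open>h\<close> on the larger ball suffices, since the product with
  \<rho> vanishes outside the smaller one.\<close>

lemma smooth_bump_ext:
  assumes "Cinf_on (ball (c p) R) h"
  shows "smooth_fun A (bump_ext h)"
proof -
  have "Cinf_on (c ` U) (\<lambda>x. \<rho> x * h x)"
    unfolding Cinf_on_def
  proof
    fix k
    have \<rho>: "Ck_on k S \<rho>" for S
      using bump(1) Ck_on_subset unfolding Cinf_on_def by blast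
    have "open (c ` U - cball (c p) r)"
      using chart(2)[OF chart_in_atlas] by (simp add: open_Diff)
    moreover from this have "Ck_on k (c ` U - cball (c p) r) (\<lambda>x. \<rho> x * h x)"
      by (rule Ck_on_cong[OF _ _ Ck_on_const[of _ _ 0]]) (use bump(3) in auto)
    moreover have "Ck_on k (ball (c p) R) (\<lambda>x. \<rho> x * h x)"
      using assms \<rho> by (auto simp: Cinf_on_def intro!: Ck_on_mult)
    moreover have "c ` U - cball (c p) r \<union> ball (c p) R = c ` U"
      using ball_subset radii by auto
    ultimately show "Ck_on k (c ` U) (\<lambda>x. \<rho> x * h x)"
      using Ck_on_Un[OF _ open_ball] by metis
  qed
  moreover have "cball (c p) r \<subseteq> c ` U"
    using ball_subset radii by auto
  ultimately show ?thesis
    unfolding bump_ext_def[abs_def] using bump(3)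
    by (intro smooth_fun_zero_extension[OF chart_in_atlas _ compact_cball[of "c p" r]]) auto
qed

lemma local_has_derivative:
  assumes "smooth_fun A f" "q \<in> U"
  shows "((f \<circ> inv_into U c) has_derivative
    frechet_derivative (f \<circ> inv_into U c) (at (c q))) (at (c q))"
  by (rule Ck_on_Suc_has_derivative[OF smooth_fun_local[OF chart_in_atlas assms(1), of "Suc 0"]])
    (use assms(2) in simp)

lemma vector_field_coord_field: "vector_field A (coord_field w)"
  unfolding vector_field_def
proof (intro conjI allI impI)
  fix q
  let ?D = "\<lambda>f. frechet_derivative (f \<circ> inv_into U c) (at (c q)) w"
  have add: "?D (\<lambda>q. f q + h q) = ?D f + ?D h"
    if "smooth_fun A f" "smooth_fun A h" "q \<in> U" for f h
    using frechet_derivative_at[OF has_derivative_add[OF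
        local_has_derivative[OF that(1,3)] local_has_derivative[OF that(2,3)]], THEN fun_cong, of w]
    by (simp add: comp_def)
  have mult: "?D (\<lambda>q. f q * h q) = ?D f * h q + f q * ?D h"
    if "smooth_fun A f" "smooth_fun A h" "q \<in> U" for f h
    using frechet_derivative_at[OF has_derivative_mult[OF
        local_has_derivative[OF that(1,3)] local_has_derivative[OF that(2,3)]], THEN fun_cong, of w]
    by (simp add: comp_def chart_in_atlas that)
  have scale: "?D (\<lambda>q. s * f q) = s * ?D f" if "smooth_fun A f" "q \<in> U" for s f
    using mult[OF smooth_fun_const that, of s] by (simp add: comp_def)
  show "coord_field w q \<in> tangent_space A q"
  proof (cases "q \<in> U")
    case True
    then have "coord_field w q f = (if smooth_fun A f then \<rho> (c q) * ?D f else 0)" for f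
      by (simp add: coord_field_def bump_ext_def)
    then show ?thesis
      unfolding tangent_space_def using True
      by (simp add: add mult scale smooth_fun_add smooth_fun_mult smooth_fun_const)
        (simp add: algebra_simps)
  next
    case False
    then have "coord_field w q = 0"
      by (simp add: fun_eq_iff coord_field_def bump_ext_def)
    then show ?thesis by (simp add: tangent_space_0)
  qed
next
  fix f :: "'a \<Rightarrow> real"
  assume f: "smooth_fun A f"
  have "Cinf_on (ball (c p) R) (\<lambda>x. frechet_derivative (f \<circ> inv_into U c) (at x) w)"
    using smooth_fun_local[OF chart_in_atlas f, of "Suc k" for k] ball_subset
    by (auto simp: Cinf_on_def intro: Ck_on_subset)
  then show "smooth_fun A (\<lambda>q. coord_field w q f)"
    using f by (simp add: coord_field_def smooth_bump_ext)
qed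

lemma coord_field_at_p:
  "smooth_fun A f \<Longrightarrow> coord_field w p f = frechet_derivative (f \<circ> inv_into U c) (at (c p)) w"
  by (simp add: coord_field_def)

lemma smooth_coordinate: "Cinf_on S (\<lambda>x. (x - c p) \<bullet> b)"
proof -
  have "Ck_on k UNIV (\<lambda>x. (x - c p) \<bullet> b)" for k
    using Ck_on_add[OF open_UNIV Ck_on_ident[OF open_UNIV] Ck_on_const[of _ _ "- c p"]]
    by (intro Ck_on_bounded_linear[OF bounded_linear_inner_left open_UNIV]) simp
  then show ?thesis
    unfolding Cinf_on_def using Ck_on_subset[OF _ subset_UNIV] by blast
qed

text \<open>\<rho> need not be constant near \<open>c p\<close>: the coordinate function vanishes
  there, so the term with the derivative of \<rho> drops out of the product rule.\<close>

lemma coord_field_coordinate: "coord_field w p (bump_ext (\<lambda>x. (x - c p) \<bullet> b)) = w \<bullet> b"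
proof -
  let ?x = "\<lambda>x. (x - c p) \<bullet> b"
  have "((\<lambda>x. \<rho> x * ?x x) has_derivative (\<lambda>v. \<rho> (c p) * (v \<bullet> b) +
      frechet_derivative \<rho> (at (c p)) v * ?x (c p))) (at (c p))"
  proof (rule has_derivative_mult)
    show "(\<rho> has_derivative frechet_derivative \<rho> (at (c p))) (at (c p))"
      using bump(1) Ck_on_Suc_has_derivative[of 0 UNIV \<rho>] unfolding Cinf_on_def by blast
  qed (auto intro!: derivative_eq_intros)
  then have "((\<lambda>x. \<rho> x * ?x x) has_derivative (\<lambda>v. v \<bullet> b)) (at (c p))"
    using bump(2) by simp
  then have "(bump_ext ?x \<circ> inv_into U c has_derivative (\<lambda>v. v \<bullet> b)) (at (c p))"
    by (rule has_derivative_transform_within_open[OF _ chart(2)[OF chart_in_atlas]])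
      (use p_in_U chart_in_atlas in \<open>auto simp: bump_ext_def\<close>)
  then show ?thesis
    using frechet_derivative_at coord_field_at_p[OF smooth_bump_ext[OF smooth_coordinate]] by metis
qed

text \<open>Hadamard's lemma writes f - f(p) near \<open>p\<close> as a sum of products of a
  coordinate vanishing at \<open>p\<close> and a smooth factor. The Leibniz rule then leaves only
  the values of \<open>v\<close> on the coordinates, weighted by the partial derivatives of
  \<open>f\<close>.\<close>

lemma tangent_vector_eq_coord_field:
  assumes v: "v \<in> tangent_space A p"
  shows "v = coord_field (\<Sum>b\<in>Basis. v (bump_ext (\<lambda>x. (x - c p) \<bullet> b)) *\<^sub>R b) p" (is "v = coord_field ?w p")
proof
  fix f
  show "v f = coord_field ?w p f"
  proof (cases "smooth_fun A f")
    case False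
    then have "v f = 0" using v unfolding tangent_space_def by blast
    then show ?thesis using False by (simp add: coord_field_def)
  next
    case f: True
    let ?F = "f \<circ> inv_into U c" and ?B = "ball (c p) R" and ?x = "\<lambda>b x. (x - c p) \<bullet> b"
    have p: "c p \<in> ?B" using radii by simp
    have F: "Cinf_on ?B ?F"
      using smooth_fun_local[OF chart_in_atlas f] ball_subset
      by (auto simp: Cinf_on_def intro: Ck_on_subset)
    obtain G where G: "\<And>b. Cinf_on ?B (G b)"
      "\<And>b. G b (c p) = frechet_derivative ?F (at (c p)) b"
      "\<And>x. x \<in> ?B \<Longrightarrow> ?F x = ?F (c p) + (\<Sum>b\<in>Basis. ?x b x * G b x)"
      using Hadamard[OF open_ball convex_ball p F] by blast
    let ?\<psi> = "bump_ext (\<lambda>x. 1)"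
    have "Cinf_on ?B (\<lambda>x. 1::real)"
      by (simp add: Cinf_on_def Ck_on_const)
    then have smooth: "smooth_fun A ?\<psi>" "smooth_fun A (bump_ext (?x b))" "smooth_fun A (bump_ext (G b))" for b
      by (simp_all add: smooth_bump_ext smooth_coordinate G(1))
    \<comment> \<open>Two factors \<open>?\<psi>\<close> appear on the left because coordinate and
      coefficient are each multiplied by \<rho> on the right.\<close>
    have eq: "?\<psi> q * (?\<psi> q * (f q - f p)) = (\<Sum>b\<in>Basis. bump_ext (?x b) q * bump_ext (G b) q)" for q
    proof (cases "q \<in> U \<and> c q \<in> ?B")
      case True
      then have "f q = f p + (\<Sum>b\<in>Basis. ?x b (c q) * G b (c q))"
        using G(3)[of "c q"] chart_in_atlas p_in_U by simp
      then show ?thesis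
        using True by (simp add: bump_ext_def sum_distrib_left algebra_simps)
    next
      case False
      then have "q \<in> U \<Longrightarrow> \<rho> (c q) = 0" using bump(3)[of "c q"] radii by auto
      then show ?thesis by (auto simp: bump_ext_def)
    qed
    \<comment> \<open>At \<open>p\<close> the cut-off equals 1 and \<open>f q - f p\<close>
      vanishes, so no derivative of the cut-off survives.\<close>
    have "v f = v (\<lambda>q. ?\<psi> q * (?\<psi> q * (f q - f p)))"
      by (simp add: tangent_vector_mult[OF v] tangent_vector_diff[OF v] tangent_vector_const[OF v]
          smooth f smooth_fun_intros)
    also have "\<dots> = (\<Sum>b\<in>Basis. v (bump_ext (?x b)) * frechet_derivative ?F (at (c p)) b)"
      by (simp add: eq tangent_vector_sum[OF v] tangent_vector_mult[OF v] smooth smooth_fun_intros G(2))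
    also have "\<dots> = frechet_derivative ?F (at (c p)) ?w"
      by (simp add: linear_sum[OF has_derivative_linear[OF local_has_derivative[OF f p_in_U]]]
          linear_scale[OF has_derivative_linear[OF local_has_derivative[OF f p_in_U]]])
    finally show ?thesis
      using f by (simp add: coord_field_at_p)
  qed
qed

text \<open>Injectivity holds because the coordinate functions recover \<open>w\<close>;
  surjectivity is the representation of derivations just proved. Together they identify the tangent
  space with the model space.\<close>

lemma coord_field_iso:
  "linear (\<lambda>w. coord_field w p)" "inj (\<lambda>w. coord_field w p)"
  "range (\<lambda>w. coord_field w p) = tangent_space A p"
proof -
  show "linear (\<lambda>w. coord_field w p)"
  proof
    fix w w' :: 'e and s :: real
    have lin: "linear (frechet_derivative (f \<circ> inv_into U c) (at (c p)))" if "smooth_fun A f" for f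
      by (rule has_derivative_linear[OF local_has_derivative[OF that p_in_U]])
    show "coord_field (w + w') p = coord_field w p + coord_field w' p"
      by (simp add: fun_eq_iff coord_field_def linear_add[OF lin])
    show "coord_field (s *\<^sub>R w) p = s *\<^sub>R coord_field w p"
      by (simp add: fun_eq_iff coord_field_def linear_scale[OF lin])
  qed
  show "inj (\<lambda>w. coord_field w p)"
  proof (rule injI, rule euclidean_eqI)
    fix w w' b :: 'e
    assume "coord_field w p = coord_field w' p"
    then show "w \<bullet> b = w' \<bullet> b"
      using coord_field_coordinate[of w b] coord_field_coordinate[of w' b] by simp
  qed
  show "range (\<lambda>w. coord_field w p) = tangent_space A p"
    using vector_field_coord_field tangent_vector_eq_coord_field unfolding vector_field_def by blast
qed

end

section \<open>Extension of tangent vectors, and bases of the kernel of a 1-form\<close>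

context smooth_manifold
begin

lemma ex_bump_chart: "\<exists>U c R r \<rho>. bump_chart A U c p R r \<rho>"
proof -
  obtain U c where U: "(U, c) \<in> A" "p \<in> U" using ex_chart by blast
  then obtain R where R: "R > 0" "ball (c p) R \<subseteq> c ` U"
    using chart(2)[OF U(1)] open_contains_ball by blast
  obtain \<rho> :: "'e \<Rightarrow> real" where "Cinf_on UNIV \<rho>" "\<rho> (c p) = 1" "\<And>x. x \<notin> cball (c p) (R/2) \<Longrightarrow> \<rho> x = 0"
    using ex_bump_fun[OF half_gt_zero[OF R(1)], of "c p"] by blast
  then have "bump_chart A U c p R (R/2) \<rho>"
    using U R by unfold_locales auto
  then show ?thesis by blast
qed

lemma ex_vector_field_extension:
  assumes "v \<in> tangent_space A p"
  obtains X where "vector_field A X" "X p = v"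
proof -
  obtain U c R r \<rho> where "bump_chart A U c p R r \<rho>" using ex_bump_chart by blast
  then interpret bump_chart A U c p R r \<rho> .
  show ?thesis
    by (rule that[OF vector_field_coord_field tangent_vector_eq_coord_field[OF assms, symmetric]])
qed

text \<open>Discharges the choice operator in \<open>extend_tvec\<close>; the witness is a cut-off
  coordinate field.\<close>

lemma extend_tvec:
  assumes "v \<in> tangent_space A p"
  shows "vector_field A (extend_tvec A p v)" "extend_tvec A p v p = v"
proof -
  have "\<exists>X. vector_field A X \<and> X p = v"
    using ex_vector_field_extension[OF assms] by blast
  then have "vector_field A (extend_tvec A p v) \<and> extend_tvec A p v p = v"
    unfolding extend_tvec_def by (rule someI_ex)
  then show "vector_field A (extend_tvec A p v)" "extend_tvec A p v p = v" by auto
qed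

lemma ex_tangent_space_iso:
  obtains \<Phi> :: "'e \<Rightarrow> 'a tvec"
  where "linear \<Phi>" "inj \<Phi>" "range \<Phi> = tangent_space A p"
proof -
  obtain U c R r \<rho> where "bump_chart A U c p R r \<rho>" using ex_bump_chart by blast
  then interpret bump_chart A U c p R r \<rho> .
  show ?thesis using that coord_field_iso by blast
qed

text \<open>Transported to the model space, the form becomes a nonzero functional on a space of
  dimension 2n + 1. Its kernel is a hyperplane, and a basis of it is pushed forward by the injective
  map \<open>\<Phi>\<close>.\<close>

lemma ex_ker_basis:
  assumes \<omega>: "linear_at A p (\<omega> p)" and u: "u \<in> tangent_space A p" "\<omega> p u = 1"
    and dim: "DIM('e) = 2 * n + 1"
  shows "\<exists>e. ker_basis A n \<omega> p e"
proof -
  obtain \<Phi> :: "'e \<Rightarrow> 'a tvec" where \<Phi>: "linear \<Phi>" "inj \<Phi>" "range \<Phi> = tangent_space A p"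
    by (rule ex_tangent_space_iso)
  have lin: "linear (\<lambda>w. \<omega> p (\<Phi> w))"
  proof
    fix w w' :: 'e and s :: real
    have T: "\<Phi> w \<in> tangent_space A p" "\<Phi> w' \<in> tangent_space A p" using \<Phi>(3) by auto
    have *: "\<omega> p (x *\<^sub>R \<Phi> w + y *\<^sub>R \<Phi> w') = x *\<^sub>R \<omega> p (\<Phi> w) + y *\<^sub>R \<omega> p (\<Phi> w')" for x y
      using \<omega> T unfolding linear_at_def by blast
    show "\<omega> p (\<Phi> (w + w')) = \<omega> p (\<Phi> w) + \<omega> p (\<Phi> w')"
      using *[of 1 1] by (simp add: linear_add[OF \<Phi>(1)])
    show "\<omega> p (\<Phi> (s *\<^sub>R w)) = s *\<^sub>R \<omega> p (\<Phi> w)"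
      using *[of s 0] by (simp add: linear_scale[OF \<Phi>(1)])
  qed
  \<comment> \<open>The vector representing the functional in the Euclidean inner product of the
    model space, which is auxiliary and unrelated to a metric on the manifold.\<close>
  define a where "a = (\<Sum>b\<in>Basis. \<omega> p (\<Phi> b) *\<^sub>R b)"
  have a: "\<omega> p (\<Phi> w) = a \<bullet> w" for w
    using has_derivative_eq_sum_Basis[OF linear_imp_has_derivative[OF lin], of w]
    by (simp add: a_def inner_sum_left inner_commute[of w] mult.commute)
  have "a \<noteq> 0"
  proof
    assume "a = 0"
    moreover obtain w where "u = \<Phi> w" using u(1) \<Phi>(3) by blast
    ultimately show False using a[of w] u(2) by simp
  qed
  let ?K = "{w. a \<bullet> w = 0}"
  obtain B where B: "B \<subseteq> ?K" "independent B" "?K \<subseteq> span B" "card B = dim ?K"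
    using basis_exists by blast
  have span_B: "span B = ?K"
    using B(1,3) subspace_hyperplane span_minimal by blast
  have "finite B" "card B = 2 * n"
    using B(2,4) dim_hyperplane[OF \<open>a \<noteq> 0\<close>] dim by (auto simp: independent_imp_finite)
  then obtain b where b: "bij_betw b {..<2 * n} B"
    using ex_bij_betw_nat_finite[of B] by (auto simp: lessThan_atLeast0)
  have "ker_basis A n \<omega> p (\<Phi> \<circ> b)"
    unfolding ker_basis_def
  proof (intro conjI)
    have img: "(\<Phi> \<circ> b) ` {..<2 * n} = \<Phi> ` B"
      using b by (simp add: bij_betw_def flip: image_image)
    show "inj_on (\<Phi> \<circ> b) {..<2 * n}"
      by (rule comp_inj_on[OF bij_betw_imp_inj_on[OF b] inj_on_subset[OF \<Phi>(2) subset_UNIV]])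
    show "independent ((\<Phi> \<circ> b) ` {..<2 * n})"
      unfolding img by (rule linear_independent_injective_image[OF \<Phi>(1) B(2)
            inj_on_subset[OF \<Phi>(2) subset_UNIV]])
    show "span ((\<Phi> \<circ> b) ` {..<2 * n}) = {u \<in> tangent_space A p. \<omega> p u = 0}"
      unfolding img linear_span_image[OF \<Phi>(1)] span_B \<Phi>(3)[symmetric] using a by auto
  qed
  then show ?thesis by blast
qed

end

section \<open>Vector fields and connections\<close>

lemma fmul_apply: "fmul f X p = f p *\<^sub>R X p"
  by (simp add: fmul_def)

lemma vector_field_in_tangent_space: "vector_field A X \<Longrightarrow> X p \<in> tangent_space A p"
  by (simp add: vector_field_def)

lemma vector_field_smooth: "vector_field A X \<Longrightarrow> smooth_fun A f \<Longrightarrow> smooth_fun A (\<lambda>p. X p f)"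
  by (simp add: vector_field_def)

lemma vector_field_eq_0_of_not_smooth: "vector_field A X \<Longrightarrow> \<not> smooth_fun A f \<Longrightarrow> X p f = 0"
  by (simp add: vector_field_def tangent_space_def)

lemma lie_bracket_skew: "lie_bracket Y X = - lie_bracket X Y"
  by (simp add: lie_bracket_def fun_eq_iff)

context smooth_manifold
begin

lemma vector_field_add: "vector_field A X \<Longrightarrow> vector_field A Y \<Longrightarrow> vector_field A (X + Y)"
  by (simp add: vector_field_def tangent_space_add smooth_fun_add)

lemma vector_field_fmul: "smooth_fun A f \<Longrightarrow> vector_field A X \<Longrightarrow> vector_field A (fmul f X)"
  by (simp add: vector_field_def fmul_def tangent_space_scale smooth_fun_mult)

lemma vector_field_0: "vector_field A 0"
  by (simp add: vector_field_def tangent_space_0 smooth_fun_const)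

lemma vector_field_uminus: "vector_field A X \<Longrightarrow> vector_field A (- X)"
  by (simp add: vector_field_def tangent_space_uminus smooth_fun_uminus)

lemma vector_field_diff: "vector_field A X \<Longrightarrow> vector_field A Y \<Longrightarrow> vector_field A (X - Y)"
  by (simp add: vector_field_def tangent_space_diff smooth_fun_diff)

text \<open>The cross terms (Xf)(Yh) + (Yf)(Xh) in XY(fh) are symmetric in \<open>X\<close> and
  \<open>Y\<close>, so the commutator is again a derivation.\<close>

lemma vector_field_lie_bracket:
  assumes X: "vector_field A X" and Y: "vector_field A Y"
  shows "vector_field A (lie_bracket X Y)"
proof -
  note T = vector_field_in_tangent_space
  note rules = tangent_vector_add[OF T[OF X]] tangent_vector_add[OF T[OF Y]]
    tangent_vector_scale[OF T[OF X]] tangent_vector_scale[OF T[OF Y]]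
    tangent_vector_mult[OF T[OF X]] tangent_vector_mult[OF T[OF Y]]
    tangent_vector_const[OF T[OF X]] tangent_vector_const[OF T[OF Y]]
    vector_field_smooth[OF X] vector_field_smooth[OF Y]
    vector_field_eq_0_of_not_smooth[OF X] vector_field_eq_0_of_not_smooth[OF Y]
  have "lie_bracket X Y p \<in> tangent_space A p" for p
    unfolding tangent_space_def mem_Collect_eq lie_bracket_def
    by (intro conjI allI impI) (simp_all add: rules smooth_fun_add smooth_fun_mult algebra_simps)
  then show ?thesis
    by (simp add: vector_field_def lie_bracket_def rules smooth_fun_diff)
qed

lemmas vector_field_intros =
  vector_field_add vector_field_fmul vector_field_0 vector_field_uminus vector_field_diff
  vector_field_lie_bracket

lemma lie_bracket_fmul:
  assumes X: "vector_field A X" and Y: "vector_field A Y" and f: "smooth_fun A f"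
  shows "lie_bracket (fmul f X) Y = fmul f (lie_bracket X Y) - fmul (\<lambda>p. Y p f) X"
proof (intro ext)
  fix p h
  note T = vector_field_in_tangent_space
  show "lie_bracket (fmul f X) Y p h = (fmul f (lie_bracket X Y) - fmul (\<lambda>p. Y p f) X) p h"
  \<comment> \<open>The derivation rules hold for smooth arguments only; at any other
    \<open>h\<close> both sides vanish by convention.\<close>
  proof (cases "smooth_fun A h")
    case True
    then show ?thesis
      by (simp add: lie_bracket_def fmul_apply tangent_vector_mult[OF T[OF Y]] f
          vector_field_smooth[OF X] algebra_simps)
  next
    case False
    then show ?thesis
      by (simp add: lie_bracket_def fmul_apply vector_field_eq_0_of_not_smooth[OF X]
          vector_field_eq_0_of_not_smooth[OF Y] tangent_vector_const[OF T[OF X]]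
          tangent_vector_const[OF T[OF Y]])
  qed
qed

lemma lie_bracket_add:
  assumes X: "vector_field A X" and V: "vector_field A V" and Y: "vector_field A Y"
  shows "lie_bracket (X + V) Y = lie_bracket X Y + lie_bracket V Y"
proof (intro ext)
  fix p h
  note T = vector_field_in_tangent_space
  show "lie_bracket (X + V) Y p h = (lie_bracket X Y + lie_bracket V Y) p h"
  proof (cases "smooth_fun A h")
    case True
    then show ?thesis
      by (simp add: lie_bracket_def tangent_vector_add[OF T[OF Y]]
          vector_field_smooth[OF X] vector_field_smooth[OF V] algebra_simps)
  next
    case False
    then show ?thesis
      by (simp add: lie_bracket_def vector_field_eq_0_of_not_smooth[OF X]
          vector_field_eq_0_of_not_smooth[OF Y] vector_field_eq_0_of_not_smooth[OF V]
          tangent_vector_const[OF T[OF X]]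
          tangent_vector_const[OF T[OF Y]] tangent_vector_const[OF T[OF V]])
  qed
qed

lemma lie_bracket_jacobi:
  assumes "vector_field A X" "vector_field A Y" "vector_field A Z"
  shows "lie_bracket X (lie_bracket Y Z) + lie_bracket Y (lie_bracket Z X)
    + lie_bracket Z (lie_bracket X Y) = 0"
proof (intro ext)
  fix p h
  note T = vector_field_in_tangent_space
  show "(lie_bracket X (lie_bracket Y Z) + lie_bracket Y (lie_bracket Z X)
    + lie_bracket Z (lie_bracket X Y)) p h = 0 p h"
  proof (cases "smooth_fun A h")
    case True
    then show ?thesis
      by (simp add: lie_bracket_def assms[THEN T, THEN tangent_vector_diff]
          assms[THEN vector_field_smooth] algebra_simps)
  next
    case False
    then show ?thesis
      by (simp add: lie_bracket_def assms[THEN vector_field_eq_0_of_not_smooth]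
          assms[THEN T, THEN tangent_vector_const])
  qed
qed

end

section \<open>Linear connections and the tensoriality of their curvature\<close>

locale connection = smooth_manifold A
  for A :: "('a::{t2_space,second_countable_topology}, 'e::euclidean_space) atlas" +
  fixes D :: "'a vfield \<Rightarrow> 'a vfield \<Rightarrow> 'a vfield"
  assumes connection: "linear_connection A D"
begin

lemma nabla_vector_field: "vector_field A X \<Longrightarrow> vector_field A Y \<Longrightarrow> vector_field A (D X Y)"
  using connection unfolding linear_connection_def by blast

lemma nabla_add:
  assumes "vector_field A X" "vector_field A Y" "vector_field A Z"
  shows "D (X + Y) Z = D X Z + D Y Z" "D X (Y + Z) = D X Y + D X Z"
  using connection assms unfolding linear_connection_def by blast+

lemma nabla_fmul:
  assumes "smooth_fun A f" "vector_field A X" "vector_field A Y"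
  shows "D (fmul f X) Y = fmul f (D X Y)" "D X (fmul f Y) = fmul (\<lambda>p. X p f) Y + fmul f (D X Y)"
  using connection assms unfolding linear_connection_def by blast+

lemma nabla_uminus:
  assumes X: "vector_field A X" and Y: "vector_field A Y"
  shows "D (- X) Y = - D X Y" "D X (- Y) = - D X Y"
proof -
  have minus: "- V = fmul (\<lambda>_. -1) V" for V :: "'a vfield"
    by (simp add: fmul_def fun_eq_iff)
  show "D (- X) Y = - D X Y" "D X (- Y) = - D X Y"
    unfolding minus nabla_fmul[OF smooth_fun_const X Y]
    using tangent_vector_const[OF vector_field_in_tangent_space[OF X]]
    by (simp_all add: fmul_def fun_eq_iff)
qed

lemma nabla_diff:
  assumes "vector_field A X" "vector_field A Y" "vector_field A Z"
  shows "D (X - Y) Z = D X Z - D Y Z" "D X (Y - Z) = D X Y - D X Z"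
  using nabla_add[of X "- Y" Z] nabla_add[of X Y "- Z"] assms
  by (simp_all add: nabla_uminus vector_field_uminus)

lemma nabla_0: "vector_field A X \<Longrightarrow> D X 0 = 0"
  using nabla_diff(2)[of X X X] vector_field_diff by simp

lemma curvature_vector_field:
  "vector_field A X \<Longrightarrow> vector_field A Y \<Longrightarrow> vector_field A Z \<Longrightarrow> vector_field A (curvature D X Y Z)"
  by (simp add: curvature_def vector_field_intros nabla_vector_field)

lemma curvature_skew:
  assumes "vector_field A X" "vector_field A Y" "vector_field A Z"
  shows "curvature D Y X Z = - curvature D X Y Z"
  using assms
  by (simp add: curvature_def lie_bracket_skew[of Y X] nabla_uminus vector_field_lie_bracket)

lemma curvature_add1:
  assumes "vector_field A X" "vector_field A V" "vector_field A Y" "vector_field A Z"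
  shows "curvature D (X + V) Y Z = curvature D X Y Z + curvature D V Y Z"
  using assms
  by (simp add: curvature_def lie_bracket_add nabla_add nabla_vector_field vector_field_lie_bracket)

lemma curvature_add3:
  assumes "vector_field A X" "vector_field A Y" "vector_field A Z" "vector_field A V"
  shows "curvature D X Y (Z + V) = curvature D X Y Z + curvature D X Y V"
  using assms
  by (simp add: curvature_def nabla_add nabla_vector_field vector_field_lie_bracket)

text \<open>The term (Yf) D_X Z from differentiating \<open>fmul f (D X Z)\<close> cancels against
  the one from [fX, Y] = f [X, Y] - (Yf) X.\<close>

lemma curvature_fmul1:
  assumes "vector_field A X" "vector_field A Y" "vector_field A Z" "smooth_fun A f"
  shows "curvature D (fmul f X) Y Z = fmul f (curvature D X Y Z)"
  using assms
  by (simp add: curvature_def lie_bracket_fmul nabla_fmul nabla_diff nabla_vector_field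
      vector_field_intros vector_field_smooth)
    (simp add: fmul_def fun_eq_iff algebra_simps)

text \<open>The first-order terms in \<open>f\<close> are symmetric in \<open>X\<close> and
  \<open>Y\<close>, and the second-order ones combine to XYf - YXf - [X, Y]f = 0.\<close>

lemma curvature_fmul3:
  assumes "vector_field A X" "vector_field A Y" "vector_field A Z" "smooth_fun A f"
  shows "curvature D X Y (fmul f Z) = fmul f (curvature D X Y Z)"
  using assms
  by (simp add: curvature_def nabla_fmul nabla_add nabla_vector_field
      vector_field_intros vector_field_smooth)
    (simp add: fmul_def fun_eq_iff lie_bracket_def algebra_simps)

lemma curvature_add2:
  assumes "vector_field A X" "vector_field A Y" "vector_field A V" "vector_field A Z"
  shows "curvature D X (Y + V) Z = curvature D X Y Z + curvature D X V Z"
  using curvature_add1[of Y V X Z] assms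
  by (simp add: curvature_skew[of _ X] vector_field_add)

lemma curvature_fmul2:
  assumes "vector_field A X" "vector_field A Y" "vector_field A Z" "smooth_fun A f"
  shows "curvature D X (fmul f Y) Z = fmul f (curvature D X Y Z)"
  using curvature_fmul1[of Y X Z f] assms
  by (simp add: curvature_skew[of _ X] vector_field_fmul) (simp add: fmul_def fun_eq_iff)

text \<open>Connections form an affine space over tensors: the derivative of \<open>f\<close> in the
  Leibniz rule is already supplied by \<open>D\<close>.\<close>

lemma linear_connection_add_tensor:
  assumes "\<And>X Y. vector_field A X \<Longrightarrow> vector_field A Y \<Longrightarrow> vector_field A (Q X Y)"
    and "\<And>X Y Z. vector_field A X \<Longrightarrow> vector_field A Y \<Longrightarrow> vector_field A Z \<Longrightarrow>
      Q (X + Y) Z = Q X Z + Q Y Z \<and> Q X (Y + Z) = Q X Y + Q X Z"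
    and "\<And>f X Y. smooth_fun A f \<Longrightarrow> vector_field A X \<Longrightarrow> vector_field A Y \<Longrightarrow>
      Q (fmul f X) Y = fmul f (Q X Y) \<and> Q X (fmul f Y) = fmul f (Q X Y)"
  shows "linear_connection A (\<lambda>X Y. D X Y + Q X Y)"
  unfolding linear_connection_def
  by (intro conjI allI impI)
    (simp_all add: assms nabla_add nabla_fmul nabla_vector_field vector_field_add,
      simp_all add: fmul_def fun_eq_iff algebra_simps)

end

text \<open>For connections prescribed by a formula that is imposed on vector fields only.\<close>

lemma linear_connection_cong:
  assumes "linear_connection A D"
    and "\<And>X Y. vector_field A X \<Longrightarrow> vector_field A Y \<Longrightarrow> D' X Y = D X Y"
    and "smooth_atlas A"
  shows "linear_connection A D'"
proof -
  interpret smooth_manifold A by unfold_locales fact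
  show ?thesis
    using assms(1) unfolding linear_connection_def
    by (simp add: assms(2) vector_field_add vector_field_fmul)
qed

section \<open>Metrics\<close>

locale metric_manifold = smooth_manifold A
  for A :: "('a::{t2_space,second_countable_topology}, 'e::euclidean_space) atlas" +
  fixes g :: "'a \<Rightarrow> 'a tvec \<Rightarrow> 'a tvec \<Rightarrow> real"
  assumes metric: "pseudo_riemannian_metric A g"
begin

lemma metric_sym: "u \<in> tangent_space A p \<Longrightarrow> v \<in> tangent_space A p \<Longrightarrow> g p u v = g p v u"
  using metric unfolding pseudo_riemannian_metric_def by blast

lemma metric_smooth: "vector_field A X \<Longrightarrow> vector_field A Y \<Longrightarrow> smooth_fun A (\<lambda>p. g p (X p) (Y p))"
  using metric unfolding pseudo_riemannian_metric_def by blast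

lemma metric_linear:
  assumes "u \<in> tangent_space A p" "v \<in> tangent_space A p" "w \<in> tangent_space A p"
  shows "g p u (r *\<^sub>R v + s *\<^sub>R w) = r * g p u v + s * g p u w"
proof -
  have "linear_at A p (g p u)"
    using metric assms(1) by (simp add: pseudo_riemannian_metric_def)
  then show ?thesis
    using assms(2,3) by (simp add: linear_at_def)
qed

lemma metric_scale_right:
  "u \<in> tangent_space A p \<Longrightarrow> v \<in> tangent_space A p \<Longrightarrow> g p u (r *\<^sub>R v) = r * g p u v"
  using metric_linear[of u p v v r 0] by simp

lemma metric_minus_right:
  "u \<in> tangent_space A p \<Longrightarrow> v \<in> tangent_space A p \<Longrightarrow> g p u (- v) = - g p u v"
  using metric_scale_right[of u p v "-1"] by simp

lemma metric_add_right:
  "u \<in> tangent_space A p \<Longrightarrow> v \<in> tangent_space A p \<Longrightarrow> w \<in> tangent_space A p \<Longrightarrow>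
    g p u (v + w) = g p u v + g p u w"
  using metric_linear[of u p v w 1 1] by simp

lemma metric_diff_right:
  "u \<in> tangent_space A p \<Longrightarrow> v \<in> tangent_space A p \<Longrightarrow> w \<in> tangent_space A p \<Longrightarrow>
    g p u (v - w) = g p u v - g p u w"
  using metric_linear[of u p v w 1 "-1"] by simp

lemmas metric_right = metric_scale_right metric_minus_right metric_add_right metric_diff_right

lemma metric_scale_left:
  "u \<in> tangent_space A p \<Longrightarrow> v \<in> tangent_space A p \<Longrightarrow> g p (r *\<^sub>R v) u = r * g p v u"
  using metric_scale_right[of u p v r] metric_sym[of u p v]
    metric_sym[of u p "r *\<^sub>R v"] tangent_space_scale[of v A p r] by simp

lemma metric_minus_left:
  "u \<in> tangent_space A p \<Longrightarrow> v \<in> tangent_space A p \<Longrightarrow> g p (- v) u = - g p v u"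
  using metric_scale_left[of u p v "-1"] by simp

lemma metric_add_left:
  "u \<in> tangent_space A p \<Longrightarrow> v \<in> tangent_space A p \<Longrightarrow> w \<in> tangent_space A p \<Longrightarrow>
    g p (v + w) u = g p v u + g p w u"
  using metric_add_right[of u p v w] metric_sym[of u p v] metric_sym[of u p w]
    metric_sym[of u p "v + w"] tangent_space_add[of v A p w] by simp

lemma metric_diff_left:
  "u \<in> tangent_space A p \<Longrightarrow> v \<in> tangent_space A p \<Longrightarrow> w \<in> tangent_space A p \<Longrightarrow>
    g p (v - w) u = g p v u - g p w u"
  using metric_diff_right[of u p v w] metric_sym[of u p v] metric_sym[of u p w]
    metric_sym[of u p "v - w"] tangent_space_diff[of v A p w] by simp

lemmas metric_left = metric_scale_left metric_minus_left metric_add_left metric_diff_left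

text \<open>The device by which scalar identities against a test vector become identities of
  vectors.\<close>

lemma metric_nondegenerate:
  assumes "u \<in> tangent_space A p" "u' \<in> tangent_space A p"
    and "\<And>v. v \<in> tangent_space A p \<Longrightarrow> g p u v = g p u' v"
  shows "u = u'"
proof -
  have "g p (u - u') v = 0" if "v \<in> tangent_space A p" for v
    using metric_diff_left[OF that assms(1,2)] assms(3)[OF that] by simp
  then have "u - u' = 0"
    using metric tangent_space_diff[OF assms(1,2)] unfolding pseudo_riemannian_metric_def by blast
  then show ?thesis by simp
qed

lemma tensor04_curvature4:
  assumes "linear_connection A D"
  shows "tensor04 A (curvature4 g D)"
proof -
  interpret connection A D by unfold_locales fact
  note T = vector_field_in_tangent_space
  show ?thesis
    unfolding tensor04_def
    by (intro allI impI conjI)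
      (simp_all add: curvature4_def curvature_vector_field metric_smooth
        curvature_add1 curvature_add2 curvature_add3 curvature_fmul1 curvature_fmul2 curvature_fmul3
        fun_eq_iff fmul_apply metric_left metric_right T tangent_space_scale)
qed

end

section \<open>Curvature symmetries of the Levi-Civita connection\<close>

locale levi_civita = metric_manifold A g
  for A :: "('a::{t2_space,second_countable_topology}, 'e::euclidean_space) atlas" and g +
  fixes D :: "'a vfield \<Rightarrow> 'a vfield \<Rightarrow> 'a vfield"
  assumes levi_civita: "levi_civita_connection A g D"

sublocale levi_civita \<subseteq> connection A D
  using levi_civita by unfold_locales (simp add: levi_civita_connection_def)

context levi_civita
begin

lemma torsion_free: "vector_field A X \<Longrightarrow> vector_field A Y \<Longrightarrow> lie_bracket X Y = D X Y - D Y X"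
  using levi_civita unfolding levi_civita_connection_def by force

lemma metric_compatible:
  "vector_field A X \<Longrightarrow> vector_field A Y \<Longrightarrow> vector_field A Z \<Longrightarrow>
    X p (\<lambda>q. g q (Y q) (Z q)) = g p (D X Y p) (Z p) + g p (Y p) (D X Z p)"
  using levi_civita unfolding levi_civita_connection_def by blast

text \<open>Without torsion every bracket can be written with \<open>D\<close>, and the cyclic sum
  of curvatures regroups into the Jacobi identity.\<close>

lemma bianchi:
  assumes "vector_field A X" "vector_field A Y" "vector_field A Z"
  shows "curvature D X Y Z + curvature D Y Z X + curvature D Z X Y = 0"
proof -
  note V = assms nabla_vector_field vector_field_lie_bracket
  have *: "lie_bracket X (lie_bracket Y Z) =
      D X (D Y Z) - D X (D Z Y) - D (lie_bracket Y Z) X"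
    if "vector_field A X" "vector_field A Y" "vector_field A Z" for X Y Z
    using that torsion_free[of X "lie_bracket Y Z"] torsion_free[of Y Z]
    by (simp add: nabla_diff nabla_vector_field vector_field_diff)
  have "curvature D X Y Z + curvature D Y Z X + curvature D Z X Y =
      lie_bracket X (lie_bracket Y Z) + lie_bracket Y (lie_bracket Z X)
        + lie_bracket Z (lie_bracket X Y)"
    unfolding *[OF assms] *[OF assms(2,3,1)] *[OF assms(3,1,2)] curvature_def by simp
  then show ?thesis
    using lie_bracket_jacobi[OF assms] by simp
qed

text \<open>Apply [X, Y] = XY - YX to the function g(Z, U) and expand with metric compatibility; the
  mixed first-order terms are symmetric in \<open>X\<close>, \<open>Y\<close> and cancel.\<close>

lemma curvature_metric_skew:
  assumes X: "vector_field A X" and Y: "vector_field A Y" and Z: "vector_field A Z"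
    and U: "vector_field A U"
  shows "g p (curvature D X Y Z p) (U p) = - g p (Z p) (curvature D X Y U p)"
proof -
  note T = vector_field_in_tangent_space
  note V = X Y Z U nabla_vector_field vector_field_lie_bracket
  have second: "X p (\<lambda>q. Y q (\<lambda>r. g r (Z r) (U r))) =
      g p (D X (D Y Z) p) (U p) + g p (D Y Z p) (D X U p)
      + (g p (D X Z p) (D Y U p) + g p (Z p) (D X (D Y U) p))"
    if "vector_field A X" "vector_field A Y" for X Y
    by (simp add: that V metric_compatible metric_smooth
        tangent_vector_add[OF T[OF that(1)]])
  have "lie_bracket X Y p (\<lambda>r. g r (Z r) (U r)) =
      X p (\<lambda>q. Y q (\<lambda>r. g r (Z r) (U r))) - Y p (\<lambda>q. X q (\<lambda>r. g r (Z r) (U r)))"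
    by (simp add: lie_bracket_def)
  then show ?thesis
    unfolding second[OF X Y] second[OF Y X]
    by (simp add: metric_compatible V curvature_def metric_left metric_right T tangent_space_intros)
qed

lemma curvature_like_curvature4: "curvature_like A (curvature4 g D)"
  unfolding curvature_like_def
proof (intro conjI allI impI tensor04_curvature4 connection)
  fix X Y Z U
  assume V: "vector_field A X" "vector_field A Y" "vector_field A Z" "vector_field A U"
  note T = vector_field_in_tangent_space
  show "curvature4 g D X Y Z U = - curvature4 g D Y X Z U"
    by (simp add: curvature4_def curvature_skew[of X Y] V fun_eq_iff metric_left T curvature_vector_field)
  show "curvature4 g D X Y Z U = - curvature4 g D X Y U Z"
  proof
    fix p
    have "g p (curvature D X Y U p) (Z p) = g p (Z p) (curvature D X Y U p)"
      by (rule metric_sym) (simp_all add: T V curvature_vector_field)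
    then show "curvature4 g D X Y Z U p = (- curvature4 g D X Y U Z) p"
      by (simp add: curvature4_def curvature_metric_skew[OF V])
  qed
  show "curvature4 g D X Y Z U + curvature4 g D Y Z X U + curvature4 g D Z X Y U = 0"
  proof
    fix p
    have "curvature D X Y Z p + curvature D Y Z X p + curvature D Z X Y p = 0"
      using bianchi[of X Y Z] V by (simp add: fun_eq_iff)
    then have "g p (curvature D X Y Z p + curvature D Y Z X p + curvature D Z X Y p) (U p) = 0"
      using metric_scale_left[OF T[OF V(4)] tangent_space_0, of p 0] by simp
    then show "(curvature4 g D X Y Z U + curvature4 g D Y Z X U + curvature4 g D Z X Y U) p = 0 p"
      by (simp add: curvature4_def metric_left V T curvature_vector_field tangent_space_intros)
  qed
qed

end

section \<open>Almost contact structures with Norden metric\<close>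

locale norden_manifold = smooth_manifold A
  for A :: "('a::{t2_space,second_countable_topology}, 'e::euclidean_space) atlas" +
  fixes n :: nat and \<phi> :: "'a \<Rightarrow> 'a tvec \<Rightarrow> 'a tvec" and \<xi> :: "'a vfield"
    and \<eta> :: "'a \<Rightarrow> 'a tvec \<Rightarrow> real" and g :: "'a \<Rightarrow> 'a tvec \<Rightarrow> 'a tvec \<Rightarrow> real"
  assumes norden: "almost_contact_norden A n \<phi> \<xi> \<eta> g"

sublocale norden_manifold \<subseteq> metric_manifold A g
  using norden by unfold_locales (simp add: almost_contact_norden_def)

context norden_manifold
begin

lemma dim_model: "DIM('e) = 2 * n + 1"
  using norden by (simp add: almost_contact_norden_def)

lemma xi_field: "vector_field A \<xi>"
  using norden by (simp add: almost_contact_norden_def)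

lemma phi_field: "vector_field A X \<Longrightarrow> vector_field A (endo_apply \<phi> X)"
  using norden by (simp add: almost_contact_norden_def endomorphism_field_def)

lemma eta_smooth: "vector_field A X \<Longrightarrow> smooth_fun A (\<lambda>p. \<eta> p (X p))"
  using norden by (simp add: almost_contact_norden_def one_form_def)

lemma eta_linear_at: "linear_at A p (\<eta> p)"
  using norden by (simp add: almost_contact_norden_def one_form_def)

lemma phi_tangent: "u \<in> tangent_space A p \<Longrightarrow> \<phi> p u \<in> tangent_space A p"
  using norden by (auto simp: almost_contact_norden_def endomorphism_field_def)

lemma xi_tangent: "\<xi> p \<in> tangent_space A p"
  using xi_field by (rule vector_field_in_tangent_space)

lemma phi_linear:
  assumes "u \<in> tangent_space A p" "v \<in> tangent_space A p"
  shows "\<phi> p (r *\<^sub>R u + s *\<^sub>R v) = r *\<^sub>R \<phi> p u + s *\<^sub>R \<phi> p v"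
proof -
  have "linear_at A p (\<phi> p)"
    using norden by (simp add: almost_contact_norden_def endomorphism_field_def)
  then show ?thesis using assms by (simp add: linear_at_def)
qed

lemma eta_linear:
  assumes "u \<in> tangent_space A p" "v \<in> tangent_space A p"
  shows "\<eta> p (r *\<^sub>R u + s *\<^sub>R v) = r * \<eta> p u + s * \<eta> p v"
  using eta_linear_at assms by (simp add: linear_at_def)

lemma phi_simps:
  assumes "u \<in> tangent_space A p"
  shows "\<phi> p (r *\<^sub>R u) = r *\<^sub>R \<phi> p u" "\<phi> p (- u) = - \<phi> p u"
    "v \<in> tangent_space A p \<Longrightarrow> \<phi> p (u + v) = \<phi> p u + \<phi> p v"
    "v \<in> tangent_space A p \<Longrightarrow> \<phi> p (u - v) = \<phi> p u - \<phi> p v"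
  using phi_linear[OF assms assms, of r 0] phi_linear[OF assms assms, of "-1" 0]
    phi_linear[OF assms, of v 1 1] phi_linear[OF assms, of v 1 "-1"] by simp_all

lemma eta_simps:
  assumes "u \<in> tangent_space A p"
  shows "\<eta> p (r *\<^sub>R u) = r * \<eta> p u" "\<eta> p (- u) = - \<eta> p u"
    "v \<in> tangent_space A p \<Longrightarrow> \<eta> p (u + v) = \<eta> p u + \<eta> p v"
    "v \<in> tangent_space A p \<Longrightarrow> \<eta> p (u - v) = \<eta> p u - \<eta> p v"
  using eta_linear[OF assms assms, of r 0] eta_linear[OF assms assms, of "-1" 0]
    eta_linear[OF assms, of v 1 1] eta_linear[OF assms, of v 1 "-1"] by simp_all

lemma eta_xi: "\<eta> p (\<xi> p) = 1"
  using norden by (simp add: almost_contact_norden_def)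

lemma phi_phi: "u \<in> tangent_space A p \<Longrightarrow> \<phi> p (\<phi> p u) = - u + \<eta> p u *\<^sub>R \<xi> p"
  using norden by (simp add: almost_contact_norden_def)

lemma metric_phi_phi:
  "u \<in> tangent_space A p \<Longrightarrow> v \<in> tangent_space A p \<Longrightarrow>
    g p (\<phi> p u) (\<phi> p v) = - g p u v + \<eta> p u * \<eta> p v"
  using norden by (simp add: almost_contact_norden_def)

text \<open>\<phi> applied three times to \<xi> is 0 since \<phi>(\<phi> \<xi>) = 0; the structure
  equation at \<phi> \<xi> then makes \<phi> \<xi> a multiple s \<xi>. Applying \<phi> once more
  gives s^2 \<xi> = 0, and \<xi> is nonzero.\<close>

lemma phi_xi: "\<phi> p (\<xi> p) = 0"
proof -
  have phi2: "\<phi> p (\<phi> p (\<xi> p)) = 0"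
    by (simp add: phi_phi[OF xi_tangent] eta_xi)
  define s where "s = \<eta> p (\<phi> p (\<xi> p))"
  have phi: "\<phi> p (\<xi> p) = s *\<^sub>R \<xi> p"
    using phi_phi[OF phi_tangent[OF xi_tangent], of p] phi_simps(1)[OF xi_tangent, of p 0]
    by (simp add: phi2 s_def)
  have "(s * s) *\<^sub>R \<xi> p = 0"
    using phi2 by (simp add: phi phi_simps(1)[OF xi_tangent])
  moreover have "\<xi> p \<noteq> 0"
    using eta_xi[of p] eta_simps(1)[OF xi_tangent, of p 0] by auto
  ultimately show ?thesis
    using phi by simp
qed

text \<open>The cube of \<phi> is computed in two ways, as \<phi> after its square and as its square
  after \<phi>.\<close>

lemma eta_phi:
  assumes u: "u \<in> tangent_space A p"
  shows "\<eta> p (\<phi> p u) = 0"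
proof -
  have "\<phi> p (- u + \<eta> p u *\<^sub>R \<xi> p) = - \<phi> p u"
    by (simp add: phi_simps phi_xi u xi_tangent tangent_space_intros)
  then have "- \<phi> p u + \<eta> p (\<phi> p u) *\<^sub>R \<xi> p = - \<phi> p u"
    using phi_phi[OF phi_tangent[OF u]] phi_phi[OF u] by simp
  then have "\<eta> p (\<phi> p u) *\<^sub>R \<xi> p = 0 *\<^sub>R \<xi> p"
    by simp
  from arg_cong[OF this, of "\<eta> p"] show ?thesis
    unfolding eta_simps(1)[OF xi_tangent] eta_xi by simp
qed

text \<open>The compatibility of \<phi> and g at v = \<xi>, where \<phi> \<xi> = 0.\<close>

lemma metric_xi_right: "u \<in> tangent_space A p \<Longrightarrow> g p u (\<xi> p) = \<eta> p u"
  using metric_phi_phi[OF _ xi_tangent, of u p] metric_scale_right[OF phi_tangent xi_tangent, of u p 0]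
  by (simp add: phi_xi eta_xi)

lemma metric_xi_left: "u \<in> tangent_space A p \<Longrightarrow> g p (\<xi> p) u = \<eta> p u"
  using metric_sym[OF xi_tangent] metric_xi_right by simp

text \<open>Replace v by \<phi> v in the compatibility of \<phi> and g; the \<eta>-terms vanish
  because \<eta> kills the image of \<phi>.\<close>

lemma metric_phi_left:
  assumes u: "u \<in> tangent_space A p" and v: "v \<in> tangent_space A p"
  shows "g p (\<phi> p u) v = g p u (\<phi> p v)"
  using metric_phi_phi[OF u phi_tangent[OF v]]
  by (simp add: phi_phi v metric_right phi_tangent u xi_tangent tangent_space_intros metric_xi_right
      eta_phi)

lemma structure_0: "\<phi> p 0 = 0" "\<eta> p 0 = 0"
  "u \<in> tangent_space A p \<Longrightarrow> g p u 0 = 0" "u \<in> tangent_space A p \<Longrightarrow> g p 0 u = 0"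
  using phi_simps(1)[OF tangent_space_0, of p 0] eta_simps(1)[OF tangent_space_0, of p 0]
    metric_scale_right[OF _ tangent_space_0, of u p 0] metric_scale_left[OF _ tangent_space_0, of u p 0]
  by simp_all

lemmas tangent_intros = tangent_space_intros phi_tangent xi_tangent

lemmas structure_simps =
  structure_0 phi_simps eta_simps metric_left metric_right eta_xi phi_phi metric_phi_phi phi_xi eta_phi
  metric_xi_right metric_xi_left

end

section \<open>The 1-forms \<open>theta\<close> and \<open>theta_star\<close> in the class
  considered\<close>

locale norden_levi_civita = norden_manifold A n \<phi> \<xi> \<eta> g + levi_civita A g D
  for A :: "('a::{t2_space,second_countable_topology}, 'e::euclidean_space) atlas"
    and n \<phi> \<xi> \<eta> g D
begin

text \<open>The class condition involves the fields only through their values at \<open>p\<close>,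
  so the chosen extensions do not matter. With \<eta>(v) = 0 one summand of each form drops out and
  \<eta>(w) factors out.\<close>

lemma fundamental_tensor_at_eq:
  assumes F: "class_F4_F5 A n \<phi> \<xi> \<eta> g D"
    and u: "u \<in> tangent_space A p" and v: "v \<in> tangent_space A p" and w: "w \<in> tangent_space A p"
    and "\<eta> p v = 0"
  shows "fundamental_tensor_at A \<phi> g D p u v w =
    (- (theta A n \<phi> \<eta> g D p (\<xi> p) / (2 * real n)) * g p (\<phi> p u) (\<phi> p v)
      - theta_star A n \<phi> \<eta> g D p (\<xi> p) / (2 * real n) * g p (\<phi> p u) v) * \<eta> p w"
proof -
  have "fundamental_tensor_at A \<phi> g D p u v w =
      F4_form A n \<phi> \<xi> \<eta> g D p u v w + F5_form A n \<phi> \<xi> \<eta> g D p u v w"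
    using F extend_tvec[OF u] extend_tvec[OF v] extend_tvec[OF w]
    unfolding fundamental_tensor_at_def class_F4_F5_def by simp
  then show ?thesis
    using assms(5) by (simp add: F4_form_def F5_form_def algebra_simps)
qed

text \<open>
  On \<open>ker \<eta>\<close> the tensor \<open>F(e\<^sub>i, e\<^sub>j, x)\<close> is a multiple of \<open>\<eta>(x)\<close> that does not depend on \<open>x\<close>,
  so no trace has to be evaluated.
\<close>

lemma theta_eq:
  assumes F: "class_F4_F5 A n \<phi> \<xi> \<eta> g D" and x: "x \<in> tangent_space A p"
  shows "theta A n \<phi> \<eta> g D p x = theta A n \<phi> \<eta> g D p (\<xi> p) * \<eta> p x"
    and "theta_star A n \<phi> \<eta> g D p x = theta_star A n \<phi> \<eta> g D p (\<xi> p) * \<eta> p x"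
proof -
  define e where "e = (SOME e. ker_basis A n \<eta> p e)"
  define h where "h = gram_inverse (2 * n) (g p) e"
  have "ker_basis A n \<eta> p e"
    unfolding e_def
    by (rule someI_ex[OF ex_ker_basis[where u="\<xi> p"]])
      (use eta_linear_at xi_tangent eta_xi dim_model in auto)
  then have e: "e i \<in> tangent_space A p" "\<eta> p (e i) = 0" if "i < 2 * n" for i
    using that span_base[of "e i" "e ` {..<2 * n}"] by (auto simp: ker_basis_def)
  note F_eq = fundamental_tensor_at_eq[OF F]
  let ?c = "theta A n \<phi> \<eta> g D p (\<xi> p) / (2 * real n)"
    and ?c' = "theta_star A n \<phi> \<eta> g D p (\<xi> p) / (2 * real n)"
  \<comment> \<open>The coefficient of \<eta>(x) in F(u, v, x) for \<open>v\<close> in the kernel of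
    \<eta>. It serves both traces, as \<phi> maps into that kernel.\<close>
  define f where "f u v = - ?c * g p (\<phi> p u) (\<phi> p v) - ?c' * g p (\<phi> p u) v" for u v
  have F1: "fundamental_tensor_at A \<phi> g D p (e i) (e j) x = f (e i) (e j) * \<eta> p x"
    and F2: "fundamental_tensor_at A \<phi> g D p (e i) (\<phi> p (e j)) x = f (e i) (\<phi> p (e j)) * \<eta> p x"
    if "i < 2 * n" "j < 2 * n" "x \<in> tangent_space A p" for i j x
    unfolding f_def using that
    by (simp_all only: F_eq[OF e(1) e(1) _ e(2)] F_eq[OF e(1) phi_tangent[OF e(1)] _ eta_phi[OF e(1)]])
  have 1: "theta A n \<phi> \<eta> g D p x = (\<Sum>i<2 * n. \<Sum>j<2 * n. h i j * f (e i) (e j)) * \<eta> p x"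
    if "x \<in> tangent_space A p" for x
    unfolding theta_def Let_def e_def[symmetric] h_def[symmetric]
    by (simp add: F1 that sum_distrib_right mult.assoc)
  have 2: "theta_star A n \<phi> \<eta> g D p x = (\<Sum>i<2 * n. \<Sum>j<2 * n. h i j * f (e i) (\<phi> p (e j))) * \<eta> p x"
    if "x \<in> tangent_space A p" for x
    unfolding theta_star_def Let_def e_def[symmetric] h_def[symmetric]
    by (simp add: F2 that sum_distrib_right mult.assoc)
  show "theta A n \<phi> \<eta> g D p x = theta A n \<phi> \<eta> g D p (\<xi> p) * \<eta> p x"
    by (simp add: 1[OF x] 1[OF xi_tangent] eta_xi)
  show "theta_star A n \<phi> \<eta> g D p x = theta_star A n \<phi> \<eta> g D p (\<xi> p) * \<eta> p x"
    by (simp add: 2[OF x] 2[OF xi_tangent] eta_xi)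
qed

end

section \<open>Covariant derivatives of \<phi>, \<xi> and \<eta>\<close>

text \<open>
  Here \<open>a\<close> and \<open>b\<close> stand for \<open>\<theta>(\<xi>)/2n\<close> and \<open>\<theta>\<^sup>*(\<xi>)/2n\<close>.
\<close>

locale f45_manifold = norden_levi_civita A n \<phi> \<xi> \<eta> g D
  for A :: "('a::{t2_space,second_countable_topology}, 'e::euclidean_space) atlas"
    and n \<phi> \<xi> \<eta> g D +
  fixes a b :: "'a \<Rightarrow> real"
  assumes a_smooth: "smooth_fun A a" and b_smooth: "smooth_fun A b"
    and F_eq: "\<And>X Y Z p. vector_field A X \<Longrightarrow> vector_field A Y \<Longrightarrow> vector_field A Z \<Longrightarrow>
      fundamental_tensor \<phi> g D X Y Z p =
        - a p * (g p (\<phi> p (X p)) (\<phi> p (Y p)) * \<eta> p (Z p) + g p (\<phi> p (X p)) (\<phi> p (Z p)) * \<eta> p (Y p))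
        - b p * (g p (\<phi> p (X p)) (Y p) * \<eta> p (Z p) + g p (\<phi> p (X p)) (Z p) * \<eta> p (Y p))"
begin

lemmas in_T = vector_field_in_tangent_space

lemmas fields = xi_field phi_field nabla_vector_field vector_field_intros

text \<open>Nondegeneracy strips the test vector z from the formula for F; each factor \<eta>(z) =
  g(\<xi>, z) turns into a component along \<xi>.\<close>

lemma nabla_phi_eq:
  assumes X: "vector_field A X" and Y: "vector_field A Y"
  shows "D X (endo_apply \<phi> Y) p = \<phi> p (D X Y p)
    - (a p * g p (\<phi> p (X p)) (\<phi> p (Y p)) + b p * g p (\<phi> p (X p)) (Y p)) *\<^sub>R \<xi> p
    - \<eta> p (Y p) *\<^sub>R (a p *\<^sub>R \<phi> p (\<phi> p (X p)) + b p *\<^sub>R \<phi> p (X p))" (is "_ = ?rhs")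
proof (rule metric_nondegenerate)
  note V = X Y fields
  note T = in_T[OF X] in_T[OF Y] tangent_intros
  show "D X (endo_apply \<phi> Y) p \<in> tangent_space A p"
    by (simp add: V in_T)
  show "?rhs \<in> tangent_space A p"
    by (simp add: V T in_T)
  fix v
  assume v: "v \<in> tangent_space A p"
  then obtain Z where Z: "vector_field A Z" "Z p = v"
    by (rule ex_vector_field_extension)
  show "g p (D X (endo_apply \<phi> Y) p) v = g p ?rhs v"
    using F_eq[OF X Y Z(1), of p] v unfolding fundamental_tensor_def Z(2)
    by (simp add: endo_apply_def[of \<phi> "D X Y"] V T in_T structure_simps metric_phi_left)
      (simp add: algebra_simps)
qed

lemma metric_compatible_xi:
  assumes X: "vector_field A X" and Y: "vector_field A Y"
  shows "X p (\<lambda>q. \<eta> q (Y q)) = \<eta> p (D X Y p) + g p (Y p) (D X \<xi> p)"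
proof -
  have "X p (\<lambda>q. g q (Y q) (\<xi> q)) = g p (D X Y p) (\<xi> p) + g p (Y p) (D X \<xi> p)"
    by (rule metric_compatible) (use X Y fields in auto)
  then show ?thesis
    by (simp add: metric_xi_right in_T X Y fields)
qed

text \<open>At y = \<xi> the formula for the derivative of \<phi> determines \<phi>(D_X \<xi>). One
  more application of \<phi> recovers D_X \<xi> itself, which lies in the kernel of \<eta> because
  g(\<xi>, \<xi>) = 1 is constant.\<close>

lemma nabla_xi:
  assumes X: "vector_field A X"
  shows "D X \<xi> p = a p *\<^sub>R \<phi> p (X p) + b p *\<^sub>R (X p - \<eta> p (X p) *\<^sub>R \<xi> p)"
proof -
  note T = in_T[OF X] in_T[OF nabla_vector_field[OF X xi_field]] tangent_intros
  have "\<eta> p (D X \<xi> p) = 0"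
    using metric_compatible_xi[OF X xi_field, of p]
    by (simp add: eta_xi metric_xi_left T tangent_vector_const[OF in_T[OF X]])
  moreover have "endo_apply \<phi> \<xi> = 0"
    by (simp add: endo_apply_def phi_xi fun_eq_iff)
  then have "\<phi> p (D X \<xi> p) = a p *\<^sub>R \<phi> p (\<phi> p (X p)) + b p *\<^sub>R \<phi> p (X p)"
    using nabla_phi_eq[OF X xi_field, of p]
    by (simp add: nabla_0[OF X] phi_xi eta_xi structure_simps T)
  then have "\<phi> p (\<phi> p (D X \<xi> p)) = \<phi> p (a p *\<^sub>R \<phi> p (\<phi> p (X p)) + b p *\<^sub>R \<phi> p (X p))"
    by simp
  ultimately show ?thesis
    by (simp add: structure_simps T) (simp add: fun_eq_iff algebra_simps)
qed

lemma metric_nabla_xi_sym: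
  assumes X: "vector_field A X" and Y: "vector_field A Y"
  shows "g p (D X \<xi> p) (Y p) = g p (X p) (D Y \<xi> p)"
  by (simp add: nabla_xi X Y structure_simps in_T tangent_intros metric_phi_left)

lemma eta_nabla_xi: "vector_field A X \<Longrightarrow> \<eta> p (D X \<xi> p) = 0"
  by (simp add: nabla_xi structure_simps in_T tangent_intros)

text \<open>The exterior derivative of \<eta> is the skew part of g(D_X \<xi>, Y), a bilinear form
  that is symmetric.\<close>

lemma eta_closed:
  assumes X: "vector_field A X" and Y: "vector_field A Y"
  shows "\<eta> p (lie_bracket X Y p) = X p (\<lambda>q. \<eta> q (Y q)) - Y p (\<lambda>q. \<eta> q (X q))"
  using metric_nabla_xi_sym[OF X Y, of p] metric_sym[of "Y p" p "D X \<xi> p"]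
  by (simp add: metric_compatible_xi X Y torsion_free eta_simps in_T fields)

text \<open>Evaluate closedness of \<omega> = f \<eta> on the pair (X, \<xi>): since \<eta> is
  closed and \<eta>(\<xi>) = 1, only Xf - \<eta>(X) \<xi>f remains.\<close>

lemma derivative_of_closed:
  assumes \<omega>: "closed_one_form A \<omega>" and f: "smooth_fun A f"
    and eq: "\<And>p x. x \<in> tangent_space A p \<Longrightarrow> \<omega> p x = f p * \<eta> p x"
    and X: "vector_field A X"
  shows "X p f = \<eta> p (X p) * \<xi> p f"
proof -
  have "X p (\<lambda>q. \<omega> q (\<xi> q)) - \<xi> p (\<lambda>q. \<omega> q (X q)) - \<omega> p (lie_bracket X \<xi> p) = 0"
    using \<omega> X xi_field unfolding closed_one_form_def by blast
  then show ?thesis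
    by (simp add: eq in_T X fields eta_xi eta_closed tangent_vector_const[OF in_T[OF X]]
        tangent_vector_mult[OF xi_tangent f eta_smooth[OF X]] algebra_simps)
qed

end

section \<open>Curvature of the almost \<open>\<phi>\<close>-connections\<close>

locale f45_closed_manifold = f45_manifold A n \<phi> \<xi> \<eta> g D a b
  for A :: "('a::{t2_space,second_countable_topology}, 'e::euclidean_space) atlas"
    and n \<phi> \<xi> \<eta> g D a b +
  assumes da: "\<And>X p. vector_field A X \<Longrightarrow> X p a = \<eta> p (X p) * \<xi> p a"
    and db: "\<And>X p. vector_field A X \<Longrightarrow> X p b = \<eta> p (X p) * \<xi> p b"
begin

lemma vfield_diff_apply: "(X - Y) p = X p - Y p" for X Y :: "'a vfield"
  by simp

lemma vfield_add_apply: "(X + Y) p = X p + Y p" for X Y :: "'a vfield"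
  by simp

lemma endo_apply_apply: "endo_apply \<phi> X p = \<phi> p (X p)"
  by (simp add: endo_apply_def)

lemmas smooths = smooth_fun_intros metric_smooth eta_smooth a_smooth b_smooth vector_field_smooth

lemma nabla_xi_field:
  "vector_field A Y \<Longrightarrow>
    D Y \<xi> = fmul a (endo_apply \<phi> Y) + fmul b (Y - fmul (\<lambda>q. \<eta> q (Y q)) \<xi>)"
  by (intro ext) (simp add: nabla_xi fmul_def endo_apply_def)

text \<open>Differentiate the formula for D_Y \<xi>. On the kernel of \<eta> the square of \<phi> is
  -1, and \<open>(b p)\<^sup>2 - (a p)\<^sup>2\<close> and \<open>2 * a p * b p\<close> are the
  coefficients of the square of the operator a \<phi> + b there.\<close>

lemma curvature_xi:
  assumes X: "vector_field A X" and Y: "vector_field A Y"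
  shows "curvature D X Y \<xi> p =
    (\<xi> p a) *\<^sub>R (\<eta> p (X p) *\<^sub>R \<phi> p (Y p) - \<eta> p (Y p) *\<^sub>R \<phi> p (X p))
    + (\<xi> p b + (b p)\<^sup>2 - (a p)\<^sup>2) *\<^sub>R (\<eta> p (X p) *\<^sub>R Y p - \<eta> p (Y p) *\<^sub>R X p)
    - (2 * a p * b p) *\<^sub>R (\<eta> p (Y p) *\<^sub>R \<phi> p (X p) - \<eta> p (X p) *\<^sub>R \<phi> p (Y p))"
proof -
  note V = X Y fields smooths
  have second: "D X (D Y \<xi>) p = (X p a) *\<^sub>R \<phi> p (Y p) + a p *\<^sub>R D X (endo_apply \<phi> Y) p
      + (X p b) *\<^sub>R (Y p - \<eta> p (Y p) *\<^sub>R \<xi> p)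
      + b p *\<^sub>R (D X Y p - X p (\<lambda>q. \<eta> q (Y q)) *\<^sub>R \<xi> p - \<eta> p (Y p) *\<^sub>R D X \<xi> p)"
    if "vector_field A X" "vector_field A Y" for X Y
    using that
    by (simp add: nabla_xi_field[of Y] nabla_add nabla_diff nabla_fmul V)
      (simp add: fmul_apply endo_apply_def)
  note T = in_T[OF X] in_T[OF Y] tangent_intros in_T[OF nabla_vector_field]
  show ?thesis
    unfolding curvature_def vfield_diff_apply second[OF X Y] second[OF Y X]
      da[OF X] da[OF Y] db[OF X] db[OF Y] nabla_phi_eq[OF X Y] nabla_phi_eq[OF Y X]
      nabla_xi[OF vector_field_lie_bracket[OF X Y]] nabla_xi[OF X] nabla_xi[OF Y] eta_closed[OF X Y]
    unfolding torsion_free[OF X Y] vfield_diff_apply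
    using metric_sym[OF in_T[OF X] in_T[OF Y], of p]
      metric_sym[OF in_T[OF Y] phi_tangent[OF in_T[OF X]], of p]
    by (simp add: structure_simps metric_phi_left T X Y)
      (simp add: fun_eq_iff power2_eq_square algebra_simps)
qed

text \<open>It annihilates \<xi>, and on fields in the kernel of \<eta> it is the \<eta>-free part
  of \<open>D\<close>. Writing it with D_X \<xi> rather than \<open>a\<close> and \<open>b\<close>
  makes the curvature computation independent of their values.\<close>

definition Dc :: "'a vfield \<Rightarrow> 'a vfield \<Rightarrow> 'a vfield" where
  "Dc X Y = D X Y + (fmul (\<lambda>p. g p (D X \<xi> p) (Y p)) \<xi> - fmul (\<lambda>p. \<eta> p (Y p)) (D X \<xi>))"

lemma linear_connection_Dc: "linear_connection A Dc"
  unfolding Dc_def[abs_def]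
proof (rule linear_connection_add_tensor, goal_cases)
  case (1 X Y)
  then show ?case by (simp add: fields smooths)
next
  case (2 X Y Z)
  then show ?case
    by (simp add: nabla_add fields structure_simps in_T fun_eq_iff fmul_def algebra_simps)
next
  case (3 f X Y)
  then show ?case
    by (simp add: nabla_fmul fields structure_simps in_T tangent_intros fmul_apply)
      (simp add: fun_eq_iff fmul_def algebra_simps)
qed

lemma Dc_apply:
  "Dc X Y p = D X Y p + g p (D X \<xi> p) (Y p) *\<^sub>R \<xi> p - \<eta> p (Y p) *\<^sub>R D X \<xi> p"
  by (simp add: Dc_def fmul_apply)

text \<open>In terms of D_X \<xi>, the derivative of \<phi> is -g(D_X \<xi>, \<phi> Y) \<xi> -
  \<eta>(Y) \<phi>(D_X \<xi>); the two added terms compensate exactly this.\<close>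

lemma Dc_phi:
  assumes X: "vector_field A X" and Y: "vector_field A Y"
  shows "Dc X (endo_apply \<phi> Y) p = \<phi> p (Dc X Y p)"
proof -
  note T = in_T[OF X] in_T[OF Y] in_T[OF nabla_vector_field] tangent_intros
  show ?thesis
    unfolding Dc_apply nabla_phi_eq[OF X Y]
    by (simp add: nabla_xi endo_apply_def[of \<phi> Y] X Y structure_simps metric_phi_left T)
qed

lemma Dc_xi: "vector_field A X \<Longrightarrow> Dc X \<xi> p = 0"
  by (simp add: Dc_apply metric_xi_right eta_nabla_xi eta_xi in_T fields)

text \<open>The component added along \<xi> is the missing term of metric compatibility, so \<eta>
  is parallel for \<open>Dc\<close>.\<close>

lemma eta_Dc:
  assumes X: "vector_field A X" and Y: "vector_field A Y"
  shows "\<eta> p (Dc X Y p) = X p (\<lambda>q. \<eta> q (Y q))"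
  using metric_sym[OF in_T[OF Y] in_T[OF nabla_vector_field[OF X xi_field]], of p]
  by (simp add: Dc_apply metric_compatible_xi eta_nabla_xi X Y structure_simps in_T fields tangent_intros)

lemma curvature_Dc:
  assumes X: "vector_field A X" and Y: "vector_field A Y" and Z: "vector_field A Z"
  shows "curvature Dc X Y Z p = curvature D X Y Z p
    + g p (curvature D X Y \<xi> p) (Z p) *\<^sub>R \<xi> p - \<eta> p (Z p) *\<^sub>R curvature D X Y \<xi> p
    + g p (D Y \<xi> p) (Z p) *\<^sub>R D X \<xi> p - g p (D X \<xi> p) (Z p) *\<^sub>R D Y \<xi> p"
proof -
  \<comment> \<open>In the commutator all terms symmetric in \<open>X\<close> and \<open>Y\<close>
    cancel: the products of D \<xi> with D Z, the product of D_X \<xi> with D_Y \<xi>, and the last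
    two summands.\<close>
  have second: "Dc X (Dc Y Z) p = D X (D Y Z) p
      + (g p (D X (D Y \<xi>) p) (Z p) + g p (D Y \<xi> p) (D X Z p) + g p (D X \<xi> p) (D Y Z p)
        - \<eta> p (Z p) * g p (D X \<xi> p) (D Y \<xi> p)) *\<^sub>R \<xi> p
      + g p (D Y \<xi> p) (Z p) *\<^sub>R D X \<xi> p - \<eta> p (Z p) *\<^sub>R D X (D Y \<xi>) p
      - X p (\<lambda>q. \<eta> q (Z q)) *\<^sub>R D Y \<xi> p - Y p (\<lambda>q. \<eta> q (Z q)) *\<^sub>R D X \<xi> p"
    if X: "vector_field A X" and Y: "vector_field A Y" for X Y
  proof -
    note V = X Y Z fields smooths
    have 1: "D X (Dc Y Z) p = D X (D Y Z) p + (g p (D X (D Y \<xi>) p) (Z p) + g p (D Y \<xi> p) (D X Z p)) *\<^sub>R \<xi> p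
        + g p (D Y \<xi> p) (Z p) *\<^sub>R D X \<xi> p - X p (\<lambda>q. \<eta> q (Z q)) *\<^sub>R D Y \<xi> p
        - \<eta> p (Z p) *\<^sub>R D X (D Y \<xi>) p"
      unfolding Dc_def
      by (simp add: nabla_add nabla_diff nabla_fmul V metric_compatible)
        (simp add: fmul_apply fun_eq_iff algebra_simps)
    have 2: "g p (D X \<xi> p) (Dc Y Z p) = g p (D X \<xi> p) (D Y Z p) - \<eta> p (Z p) * g p (D X \<xi> p) (D Y \<xi> p)"
      by (simp add: Dc_apply structure_simps V in_T tangent_intros eta_nabla_xi)
    show ?thesis
      unfolding Dc_apply[of X "Dc Y Z"] 1 2 eta_Dc[OF Y Z]
      by (simp add: fun_eq_iff algebra_simps)
  qed
  note V = X Y Z fields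
  show ?thesis
    unfolding curvature_def vfield_diff_apply second[OF X Y] second[OF Y X] Dc_apply[of "lie_bracket X Y"]
    using metric_sym[of "D X \<xi> p" p "D Y \<xi> p"]
    by (simp add: structure_simps V in_T tangent_intros eta_closed metric_compatible_xi)
      (simp add: fun_eq_iff algebra_simps eta_closed)
qed

text \<open>The terms with R(X, Y)\<xi> contribute (\<xi>a + 2ab) pi5 + (\<xi>b + b^2 - a^2) pi4,
  and the quadratic terms in D \<xi> contribute a^2 pi2 + b^2 (pi1 - pi4) - ab (pi3 + pi5).\<close>

lemma curvature4_Dc:
  assumes X: "vector_field A X" and Y: "vector_field A Y" and Z: "vector_field A Z"
    and U: "vector_field A U"
  shows "curvature4 g Dc X Y Z U p = curvature4 g D X Y Z U p
    + \<xi> p a * pi5 (\<phi> p) (\<eta> p) (g p) (X p) (Y p) (Z p) (U p)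
    + \<xi> p b * pi4 (\<eta> p) (g p) (X p) (Y p) (Z p) (U p)
    + (a p)\<^sup>2 * (pi2 (\<phi> p) (g p) (X p) (Y p) (Z p) (U p)
        - pi4 (\<eta> p) (g p) (X p) (Y p) (Z p) (U p))
    + (b p)\<^sup>2 * pi1 (g p) (X p) (Y p) (Z p) (U p)
    - a p * b p * (pi3 (\<phi> p) (g p) (X p) (Y p) (Z p) (U p)
        - pi5 (\<phi> p) (\<eta> p) (g p) (X p) (Y p) (Z p) (U p))"
proof -
  have R: "curvature D X Y Z p \<in> tangent_space A p"
    by (rule in_T[OF curvature_vector_field[OF X Y Z]])
  note T = R in_T[OF X] in_T[OF Y] in_T[OF Z] in_T[OF U] tangent_intros
  show ?thesis
    unfolding curvature4_def curvature_Dc[OF X Y Z] curvature_xi[OF X Y] nabla_xi[OF X] nabla_xi[OF Y]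
      pi1_def pi2_def pi3_def pi4_def pi5_def
    by (simp add: structure_simps metric_phi_left T) (simp add: power2_eq_square algebra_simps)
qed

text \<open>Skewness in the last pair and the cyclic identity pass from the curvature of
  \<open>D\<close> through the explicit formula. The \<phi>-identity holds because \<phi> commutes
  with the curvature operator, whose values are in the kernel of \<eta>.\<close>

lemma phi_kaehler_type_curvature4_Dc: "phi_kaehler_type A \<phi> (curvature4 g Dc)"
  unfolding phi_kaehler_type_def curvature_like_def
proof (intro conjI allI impI tensor04_curvature4 linear_connection_Dc)
  interpret Dc: connection A Dc
    by unfold_locales (rule linear_connection_Dc)
  fix X Y Z U
  assume X: "vector_field A X" and Y: "vector_field A Y" and Z: "vector_field A Z" and U: "vector_field A U"
  note T = in_T[OF X] in_T[OF Y] in_T[OF Z] in_T[OF U]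
  \<comment> \<open>Symmetry is used only in instances oriented towards the order \<open>X\<close>,
    \<open>Y\<close>, \<open>Z\<close>, \<open>U\<close>, so that rewriting reaches a normal
    form.\<close>
  note sym = metric_sym[OF T(2,1)] metric_sym[OF T(3,1)] metric_sym[OF T(4,1)]
    metric_sym[OF T(3,2)] metric_sym[OF T(4,2)] metric_sym[OF T(4,3)]
  have sym_phi: "g p v (\<phi> p u) = g p u (\<phi> p v)" if "u \<in> tangent_space A p" "v \<in> tangent_space A p" for u v p
    using metric_phi_left[OF that] metric_sym[OF phi_tangent[OF that(1)] that(2)] by simp
  note sym_phi = sym_phi[OF T(1,2)] sym_phi[OF T(1,3)] sym_phi[OF T(1,4)]
    sym_phi[OF T(2,3)] sym_phi[OF T(2,4)] sym_phi[OF T(3,4)]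
  have D_like: "curvature4 g D X Y Z U p = - curvature4 g D X Y U Z p"
    "curvature4 g D X Y Z U p + curvature4 g D Y Z X U p + curvature4 g D Z X Y U p = 0" for p
  proof -
    have "curvature4 g D X Y Z U = - curvature4 g D X Y U Z \<and>
      curvature4 g D X Y Z U + curvature4 g D Y Z X U + curvature4 g D Z X Y U = 0"
      using curvature_like_curvature4 X Y Z U unfolding curvature_like_def by blast
    from this[THEN conjunct1, THEN fun_cong, of p] this[THEN conjunct2, THEN fun_cong, of p]
    show "curvature4 g D X Y Z U p = - curvature4 g D X Y U Z p"
      "curvature4 g D X Y Z U p + curvature4 g D Y Z X U p + curvature4 g D Z X Y U p = 0"
      by simp_all
  qed
  show "curvature4 g Dc X Y Z U = - curvature4 g Dc Y X Z U"
    by (simp add: curvature4_def Dc.curvature_skew[of X Y] X Y Z fun_eq_iff metric_left T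
        in_T[OF Dc.curvature_vector_field])
  show "curvature4 g Dc X Y Z U = - curvature4 g Dc X Y U Z"
  proof
    fix p
    show "curvature4 g Dc X Y Z U p = (- curvature4 g Dc X Y U Z) p"
      unfolding fun_Compl_def curvature4_Dc[OF X Y Z U] curvature4_Dc[OF X Y U Z] D_like(1)
        pi1_def pi2_def pi3_def pi4_def pi5_def
      by (simp add: sym sym_phi algebra_simps)
  qed
  show "curvature4 g Dc X Y Z U + curvature4 g Dc Y Z X U + curvature4 g Dc Z X Y U = 0"
  proof
    fix p
    show "(curvature4 g Dc X Y Z U + curvature4 g Dc Y Z X U + curvature4 g Dc Z X Y U) p = 0 p"
      using D_like(2)[of p]
      unfolding plus_fun_apply curvature4_Dc[OF X Y Z U] curvature4_Dc[OF Y Z X U] curvature4_Dc[OF Z X Y U]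
        pi1_def pi2_def pi3_def pi4_def pi5_def
      by (simp add: sym sym_phi algebra_simps)
  qed
  show "curvature4 g Dc X Y (endo_apply \<phi> Z) (endo_apply \<phi> U) = - curvature4 g Dc X Y Z U"
  proof
    fix p
    have phi: "Dc X (endo_apply \<phi> Y) = endo_apply \<phi> (Dc X Y)"
      if "vector_field A X" "vector_field A Y" for X Y
      by (intro ext) (simp add: Dc_phi[OF that] endo_apply_def[of _ "Dc X Y"])
    note V = X Y Z U fields Dc.nabla_vector_field
    have "curvature Dc X Y (endo_apply \<phi> Z) p = \<phi> p (curvature Dc X Y Z p)"
      unfolding curvature_def vfield_diff_apply
      by (simp add: phi V) (simp add: endo_apply_def phi_simps in_T V tangent_space_intros)
    moreover have "\<eta> p (curvature Dc X Y Z p) = 0"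
      unfolding curvature_def vfield_diff_apply
      by (simp add: structure_simps in_T tangent_space_intros eta_Dc V) (simp add: lie_bracket_def)
    moreover have "endo_apply \<phi> U p = \<phi> p (U p)"
      by (simp add: endo_apply_def)
    ultimately show "curvature4 g Dc X Y (endo_apply \<phi> Z) (endo_apply \<phi> U) p = (- curvature4 g Dc X Y Z U) p"
      by (simp add: curvature4_def metric_phi_phi in_T[OF U] in_T[OF Dc.curvature_vector_field] X Y Z)
  qed
qed

end

section \<open>Adding the terms with \<lambda> and \<mu>\<close>

text \<open>
  The \<open>\<lambda>\<close>, \<open>\<mu>\<close>-terms form a tensor \<open>\<eta> \<otimes> S\<close> with \<open>S = c (id - \<eta> \<otimes> \<xi>) + d \<phi>\<close>.  It does not affect
  the curvature because \<open>\<eta>\<close> is closed and \<open>dc\<close>, \<open>dd\<close> are multiples of \<open>\<eta>\<close>.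
\<close>

locale f45_connection = f45_closed_manifold A n \<phi> \<xi> \<eta> g D a b
  for A :: "('a::{t2_space,second_countable_topology}, 'e::euclidean_space) atlas"
    and n \<phi> \<xi> \<eta> g D a b +
  fixes c d :: "'a \<Rightarrow> real"
  assumes c_smooth: "smooth_fun A c" and d_smooth: "smooth_fun A d"
    and dc: "\<And>X p. vector_field A X \<Longrightarrow> X p c = \<eta> p (X p) * \<xi> p c"
    and dd: "\<And>X p. vector_field A X \<Longrightarrow> X p d = \<eta> p (X p) * \<xi> p d"
begin

definition S :: "'a vfield \<Rightarrow> 'a vfield" where
  "S Y = fmul c (Y - fmul (\<lambda>p. \<eta> p (Y p)) \<xi>) + fmul d (endo_apply \<phi> Y)"

definition Dcd :: "'a vfield \<Rightarrow> 'a vfield \<Rightarrow> 'a vfield" where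
  "Dcd X Y = Dc X Y + fmul (\<lambda>p. \<eta> p (X p)) (S Y)"

lemma S_apply: "S Y p = c p *\<^sub>R (Y p - \<eta> p (Y p) *\<^sub>R \<xi> p) + d p *\<^sub>R \<phi> p (Y p)"
  by (simp add: S_def fmul_apply endo_apply_def)

lemma Dcd_apply: "Dcd X Y p = Dc X Y p + \<eta> p (X p) *\<^sub>R S Y p"
  by (simp add: Dcd_def fmul_apply)

lemma S_field: "vector_field A Y \<Longrightarrow> vector_field A (S Y)"
  by (simp add: S_def fields smooths c_smooth d_smooth)

lemma S_add: "vector_field A Y \<Longrightarrow> vector_field A Z \<Longrightarrow> S (Y + Z) = S Y + S Z"
  by (rule ext) (simp add: S_apply structure_simps in_T algebra_simps)

lemma S_fmul: "vector_field A Y \<Longrightarrow> S (fmul f Y) = fmul f (S Y)"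
  by (rule ext) (simp add: S_apply fmul_apply structure_simps in_T algebra_simps)

lemma linear_connection_Dcd: "linear_connection A Dcd"
proof -
  interpret Dc: connection A Dc
    by unfold_locales (rule linear_connection_Dc)
  show ?thesis
    unfolding Dcd_def[abs_def]
  proof (rule Dc.linear_connection_add_tensor, goal_cases)
    case (1 X Y)
    then show ?case by (simp add: fields smooths S_field)
  next
    case (2 X Y Z)
    then show ?case
      by (simp add: S_add structure_simps in_T fun_eq_iff fmul_def algebra_simps)
  next
    case (3 f X Y)
    then show ?case
      by (simp add: S_fmul) (simp add: structure_simps in_T fun_eq_iff fmul_def algebra_simps)
  qed
qed

lemma Dcd_phi:
  assumes X: "vector_field A X" and Y: "vector_field A Y"
  shows "Dcd X (endo_apply \<phi> Y) = endo_apply \<phi> (Dcd X Y)"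
proof
  interpret Dc: connection A Dc
    by unfold_locales (rule linear_connection_Dc)
  fix p
  note T = in_T[OF Dc.nabla_vector_field[OF X Y]] in_T[OF X] in_T[OF Y] tangent_intros
  show "Dcd X (endo_apply \<phi> Y) p = endo_apply \<phi> (Dcd X Y) p"
    by (simp only: endo_apply_apply Dcd_apply Dc_phi[OF X Y] S_apply)
      (simp add: structure_simps T)
qed

text \<open>\<open>Dc\<close> preserves \<phi>, \<xi> and \<eta>, so only the coefficients
  \<open>c\<close> and \<open>d\<close> of \<open>S\<close> are differentiated, and their
  differentials are multiples of \<eta>.\<close>

lemma Dc_S:
  assumes X: "vector_field A X" and Y: "vector_field A Y"
  shows "Dc X (S Y) p = S (Dc X Y) p
    + \<eta> p (X p) *\<^sub>R (\<xi> p c *\<^sub>R (Y p - \<eta> p (Y p) *\<^sub>R \<xi> p) + \<xi> p d *\<^sub>R \<phi> p (Y p))"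
proof -
  interpret Dc: connection A Dc
    by unfold_locales (rule linear_connection_Dc)
  note V = X Y fields smooths c_smooth d_smooth
  have "Dc X (S Y) p = X p c *\<^sub>R (Y p - \<eta> p (Y p) *\<^sub>R \<xi> p)
      + c p *\<^sub>R (Dc X Y p - X p (\<lambda>q. \<eta> q (Y q)) *\<^sub>R \<xi> p)
      + X p d *\<^sub>R \<phi> p (Y p) + d p *\<^sub>R \<phi> p (Dc X Y p)"
    unfolding S_def
    by (simp add: Dc.nabla_add Dc.nabla_diff Dc.nabla_fmul V)
      (simp only: vfield_add_apply vfield_diff_apply fmul_apply endo_apply_apply Dc_phi[OF X Y]
        Dc_xi[OF X] scaleR_zero_right add_0_right add.assoc)
  then show ?thesis
    by (simp only: S_apply eta_Dc[OF X Y] dc[OF X] dd[OF X])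
      (simp add: fun_eq_iff algebra_simps)
qed

lemma curvature_Dcd:
  assumes X: "vector_field A X" and Y: "vector_field A Y" and Z: "vector_field A Z"
  shows "curvature Dcd X Y Z = curvature Dc X Y Z"
proof
  fix p
  interpret Dc: connection A Dc
    by unfold_locales (rule linear_connection_Dc)
  \<comment> \<open>After \<open>Dc_S\<close>, the terms with \<open>S (S Z)\<close> and with the
    derivatives of \<open>c\<close>, \<open>d\<close> carry the symmetric factor \<eta>(X)
    \<eta>(Y). The terms with \<open>S (Dc X Z)\<close> and \<open>S (Dc Y Z)\<close> cancel in
    pairs, and those with \<open>S Z\<close> cancel as \<eta> is closed.\<close>
  have second: "Dcd X (Dcd Y Z) p = Dc X (Dc Y Z) p + X p (\<lambda>q. \<eta> q (Y q)) *\<^sub>R S Z p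
      + \<eta> p (Y p) *\<^sub>R Dc X (S Z) p + \<eta> p (X p) *\<^sub>R S (Dc Y Z) p
      + (\<eta> p (X p) * \<eta> p (Y p)) *\<^sub>R S (S Z) p"
    if "vector_field A X" "vector_field A Y" for X Y
    unfolding Dcd_def using that Z
    by (simp add: Dc.nabla_add Dc.nabla_fmul fields smooths S_field S_add S_fmul Dc.nabla_vector_field)
      (simp add: fmul_apply fun_eq_iff algebra_simps)
  show "curvature Dcd X Y Z p = curvature Dc X Y Z p"
    unfolding curvature_def vfield_diff_apply second[OF X Y] second[OF Y X] Dc_S[OF X Z] Dc_S[OF Y Z]
    by (simp add: Dcd_def fmul_apply eta_closed X Y) (simp add: fun_eq_iff algebra_simps)
qed

text \<open>Makes \<open>Dcd\<close> recognisable as the connection of the theorem, with general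
  coefficients.\<close>

lemma Dcd_eq:
  assumes X: "vector_field A X" and Y: "vector_field A Y"
  shows "Dcd X Y p = D X Y p
    + a p *\<^sub>R (g p (X p) (\<phi> p (Y p)) *\<^sub>R \<xi> p - \<eta> p (Y p) *\<^sub>R \<phi> p (X p))
    + b p *\<^sub>R (g p (X p) (Y p) *\<^sub>R \<xi> p - \<eta> p (Y p) *\<^sub>R X p)
    + c p *\<^sub>R (\<eta> p (X p) *\<^sub>R Y p - (\<eta> p (X p) * \<eta> p (Y p)) *\<^sub>R \<xi> p)
    + (d p * \<eta> p (X p)) *\<^sub>R \<phi> p (Y p)"
  unfolding Dcd_apply Dc_apply nabla_xi[OF X]
  by (simp add: S_apply structure_simps metric_phi_left in_T X Y tangent_intros)
    (simp add: fun_eq_iff algebra_simps)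

end

section \<open>Specialisation of the coefficients and transfer to the given connection\<close>

theorem proposition3p2:
  fixes A :: "('a::{t2_space,second_countable_topology}, 'e::euclidean_space) atlas"
    and n :: nat
    and \<phi> :: "'a \<Rightarrow> 'a tvec \<Rightarrow> 'a tvec"
    and \<xi> :: "'a vfield"
    and \<eta> :: "'a \<Rightarrow> 'a tvec \<Rightarrow> real"
    and g :: "'a \<Rightarrow> 'a tvec \<Rightarrow> 'a tvec \<Rightarrow> real"
    and D D' :: "'a vfield \<Rightarrow> 'a vfield \<Rightarrow> 'a vfield"
    and t ts :: "'a \<Rightarrow> real"
    and l m :: real
  assumes "n \<ge> 1"
    and "almost_contact_norden A n \<phi> \<xi> \<eta> g"
    and "levi_civita_connection A g D"
    and "class_F40_F50 A n \<phi> \<xi> \<eta> g D"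
    and "t = (\<lambda>p. theta A n \<phi> \<eta> g D p (\<xi> p))"
    and "ts = (\<lambda>p. theta_star A n \<phi> \<eta> g D p (\<xi> p))"
    and "\<And>X Y p. vector_field A X \<Longrightarrow> vector_field A Y \<Longrightarrow>
      D' X Y p = D X Y p
        + (t p / (2 * real n)) *\<^sub>R (g p (X p) (\<phi> p (Y p)) *\<^sub>R \<xi> p - \<eta> p (Y p) *\<^sub>R \<phi> p (X p))
        + (ts p / (2 * real n)) *\<^sub>R (g p (X p) (Y p) *\<^sub>R \<xi> p - \<eta> p (Y p) *\<^sub>R X p)
        + ((l * t p + m * ts p) / (2 * real n)) *\<^sub>R
            (\<eta> p (X p) *\<^sub>R Y p - (\<eta> p (X p) * \<eta> p (Y p)) *\<^sub>R \<xi> p)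
        + ((m * t p - l * ts p) / (2 * real n) * \<eta> p (X p)) *\<^sub>R \<phi> p (Y p)"
  shows "almost_phi_connection A \<phi> D' \<and>
    phi_kaehler_type A \<phi> (curvature4 g D') \<and>
    (\<forall>X Y Z U p. vector_field A X \<longrightarrow> vector_field A Y \<longrightarrow> vector_field A Z \<longrightarrow> vector_field A U \<longrightarrow>
      curvature4 g D' X Y Z U p = curvature4 g D X Y Z U p
        + \<xi> p t / (2 * real n) * pi5 (\<phi> p) (\<eta> p) (g p) (X p) (Y p) (Z p) (U p)
        + \<xi> p ts / (2 * real n) * pi4 (\<eta> p) (g p) (X p) (Y p) (Z p) (U p)
        + (t p)\<^sup>2 / (4 * (real n)\<^sup>2) *
            (pi2 (\<phi> p) (g p) (X p) (Y p) (Z p) (U p) - pi4 (\<eta> p) (g p) (X p) (Y p) (Z p) (U p))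
        + (ts p)\<^sup>2 / (4 * (real n)\<^sup>2) * pi1 (g p) (X p) (Y p) (Z p) (U p)
        - t p * ts p / (4 * (real n)\<^sup>2) *
            (pi3 (\<phi> p) (g p) (X p) (Y p) (Z p) (U p)
             - pi5 (\<phi> p) (\<eta> p) (g p) (X p) (Y p) (Z p) (U p)))"
proof -
  let ?N = "1 / (2 * real n)"
  \<comment> \<open>Constants are kept as left factors, the shape in which derivations release them.
    \<open>?c\<close> and \<open>?d\<close> are then constant linear combinations of
    \<open>?a\<close> and \<open>?b\<close>.\<close>
  let ?a = "\<lambda>p. ?N * t p" and ?b = "\<lambda>p. ?N * ts p"
  let ?c = "\<lambda>p. l * (?N * t p) + m * (?N * ts p)" and ?d = "\<lambda>p. m * (?N * t p) - l * (?N * ts p)"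
  interpret norden_levi_civita A n \<phi> \<xi> \<eta> g D
    using assms(2,3) by unfold_locales (simp_all add: almost_contact_norden_def)
  have F: "class_F4_F5 A n \<phi> \<xi> \<eta> g D"
    and \<theta>: "closed_one_form A (theta A n \<phi> \<eta> g D)"
    and \<theta>': "closed_one_form A (theta_star A n \<phi> \<eta> g D)"
    using assms(4) by (auto simp: class_F40_F50_def)
  \<comment> \<open>Closedness includes being a smooth 1-form, so the value on the field \<xi> is
    smooth.\<close>
  have t_smooth: "smooth_fun A t" and ts_smooth: "smooth_fun A ts"
    using \<theta> \<theta>' xi_field unfolding assms(5,6) closed_one_form_def one_form_def by blast+
  interpret f45_manifold A n \<phi> \<xi> \<eta> g D ?a ?b
  proof
    show "smooth_fun A ?a" "smooth_fun A ?b"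
      by (rule smooth_fun_mult[OF smooth_fun_const] t_smooth ts_smooth)+
    show "fundamental_tensor \<phi> g D X Y Z p =
        - ?a p * (g p (\<phi> p (X p)) (\<phi> p (Y p)) * \<eta> p (Z p) + g p (\<phi> p (X p)) (\<phi> p (Z p)) * \<eta> p (Y p))
        - ?b p * (g p (\<phi> p (X p)) (Y p) * \<eta> p (Z p) + g p (\<phi> p (X p)) (Z p) * \<eta> p (Y p))"
      if "vector_field A X" "vector_field A Y" "vector_field A Z" for X Y Z p
      using F that by (simp add: class_F4_F5_def F4_form_def F5_form_def assms(5,6))
  qed
  have dt: "X p t = \<eta> p (X p) * \<xi> p t" and dts: "X p ts = \<eta> p (X p) * \<xi> p ts"
    if "vector_field A X" for X p
  proof -
    show "X p t = \<eta> p (X p) * \<xi> p t"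
    proof (rule derivative_of_closed[OF \<theta> t_smooth _ that])
      show "theta A n \<phi> \<eta> g D p x = t p * \<eta> p x" if "x \<in> tangent_space A p" for p x
        unfolding assms(5) by (rule theta_eq(1)[OF F that])
    qed
    show "X p ts = \<eta> p (X p) * \<xi> p ts"
    proof (rule derivative_of_closed[OF \<theta>' ts_smooth _ that])
      show "theta_star A n \<phi> \<eta> g D p x = ts p * \<eta> p x" if "x \<in> tangent_space A p" for p x
        unfolding assms(6) by (rule theta_eq(2)[OF F that])
    qed
  qed
  have scale: "X p (\<lambda>q. r * t q) = r * X p t" "X p (\<lambda>q. r * ts q) = r * X p ts"
    and sum: "X p (\<lambda>q. r * (s * t q) + r' * (s' * ts q)) = r * (s * X p t) + r' * (s' * X p ts)"
    if "vector_field A X" for X p r r' s s'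
    by (simp_all add: tangent_vector_scale[OF in_T[OF that]] tangent_vector_add[OF in_T[OF that]]
        t_smooth ts_smooth smooth_fun_intros)
  have diff: "X p (\<lambda>q. r * (s * t q) - r' * (s' * ts q)) = r * (s * X p t) - r' * (s' * X p ts)"
    if "vector_field A X" for X p r r' s s'
    using sum[OF that, of p r s "- r'" s'] by simp
  interpret f45_connection A n \<phi> \<xi> \<eta> g D ?a ?b ?c ?d
  proof
    fix X p
    assume X: "vector_field A X"
    show "X p ?a = \<eta> p (X p) * \<xi> p ?a" "X p ?b = \<eta> p (X p) * \<xi> p ?b"
      "X p ?c = \<eta> p (X p) * \<xi> p ?c" "X p ?d = \<eta> p (X p) * \<xi> p ?d"
      unfolding scale[OF X] scale[OF xi_field] sum[OF X] sum[OF xi_field] diff[OF X] diff[OF xi_field]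
        dt[OF X] dts[OF X] by (simp_all add: algebra_simps)
  qed (intro smooth_fun_intros t_smooth ts_smooth)+
  have D': "D' X Y = Dcd X Y" if "vector_field A X" "vector_field A Y" for X Y
  proof
    fix p
    have coeffs: "(l * t p + m * ts p) / (2 * real n) = ?c p" "(m * t p - l * ts p) / (2 * real n) = ?d p"
      "t p / (2 * real n) = ?a p" "ts p / (2 * real n) = ?b p"
      by (simp_all add: add_divide_distrib diff_divide_distrib)
    show "D' X Y p = Dcd X Y p"
      unfolding assms(7)[OF that] Dcd_eq[OF that] coeffs ..
  qed
  interpret Dcd: connection A Dcd
    by unfold_locales (rule linear_connection_Dcd)
  have lin: "linear_connection A D'"
    by (rule linear_connection_cong[OF linear_connection_Dcd D' smooth_atlas])
  have R': "curvature4 g D' X Y Z U = curvature4 g Dc X Y Z U"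
    if "vector_field A X" "vector_field A Y" "vector_field A Z" for X Y Z U
  proof -
    \<comment> \<open>\<open>D'\<close> is known on vector fields only, so every inner derivative
      and the bracket must first be seen to be fields.\<close>
    have "curvature D' X Y Z = curvature Dcd X Y Z"
      unfolding curvature_def D'[OF that(2,3)] D'[OF that(1,3)]
        D'[OF that(1) Dcd.nabla_vector_field[OF that(2,3)]]
        D'[OF that(2) Dcd.nabla_vector_field[OF that(1,3)]]
        D'[OF vector_field_lie_bracket[OF that(1,2)] that(3)] ..
    then show ?thesis
      by (simp only: curvature4_def curvature_Dcd[OF that])
  qed
  have "almost_phi_connection A \<phi> D'"
    unfolding almost_phi_connection_def
  proof (intro conjI allI impI lin)
    fix X Y
    assume V: "vector_field A X" "vector_field A Y"
    show "D' X (endo_apply \<phi> Y) - endo_apply \<phi> (D' X Y) = 0"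
      unfolding D'[OF V] D'[OF V(1) phi_field[OF V(2)]] Dcd_phi[OF V] by (rule diff_self)
  qed
  moreover have "phi_kaehler_type A \<phi> (curvature4 g D')"
    unfolding phi_kaehler_type_def curvature_like_def
  proof (intro conjI allI impI tensor04_curvature4 lin)
    note K = phi_kaehler_type_curvature4_Dc[unfolded phi_kaehler_type_def curvature_like_def]
    fix X Y Z U
    assume V: "vector_field A X" "vector_field A Y" "vector_field A Z" "vector_field A U"
    show "curvature4 g D' X Y Z U = - curvature4 g D' Y X Z U"
      unfolding R'[OF V(1,2,3)] R'[OF V(2,1,3)] using K V by blast
    show "curvature4 g D' X Y Z U = - curvature4 g D' X Y U Z"
      unfolding R'[OF V(1,2,3)] R'[OF V(1,2,4)] using K V by blast
    show "curvature4 g D' X Y Z U + curvature4 g D' Y Z X U + curvature4 g D' Z X Y U = 0"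
      unfolding R'[OF V(1,2,3)] R'[OF V(2,3,1)] R'[OF V(3,1,2)] using K V by blast
    show "curvature4 g D' X Y (endo_apply \<phi> Z) (endo_apply \<phi> U) = - curvature4 g D' X Y Z U"
      unfolding R'[OF V(1,2,3)] R'[OF V(1,2) phi_field[OF V(3)]] using K V by blast
  qed
  \<comment> \<open>The curvature formula differentiates \<open>?a\<close> and \<open>?b\<close>,
    which the simplifier writes as quotients; the constant 1/(2n) leaves the derivative.\<close>
  moreover have "\<xi> p (\<lambda>q. t q / (2 * real n)) = \<xi> p t / (2 * real n)"
    "\<xi> p (\<lambda>q. ts q / (2 * real n)) = \<xi> p ts / (2 * real n)" for p
    using scale[OF xi_field, of p ?N] by simp_all
  ultimately show ?thesis
    by (simp add: R' curvature4_Dc power_mult_distrib power_divide) (simp add: power2_eq_square)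
qed

end
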